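(* Let $q$ be a prime power and fix an integer $t\ge 1$. For any coset of $\operatorname{SL}_n(q)$ in $\operatorname{GL}_n(q)$, the proportion (with $q$ fixed and $n\to\infty$) of elements of the coset whose characteristic polynomial has no irreducible factors over $\mathbf{F}_q$ of degree at most $t$ converges to $$\prod_{j=1}^t \prod_{i \geq 1} \left( 1 - \frac{1}{q^{ij}} \right)^{N(q;j)}.$$
   Context: $N(q;j)$ is the number of monic irreducible polynomials of degree $j$ over $\mathbf{F}_q$ with non-zero constant term. (So $N(q;1)=q-1$, and for $j>1$, $N(q;j)=\frac1j\sum_{r\mid j}\mu(r)q^{j/r}$, with $\mu$ the Moebius function.) The cosets of $\operatorname{SL}_n(q)$ in $\operatorname{GL}_n(q)$ are the sets of matrices with a given determinant in $\mathbf{F}_q^\times$. *)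

theory Defs
  imports
    "HOL-Analysis.Infinite_Products"
    "HOL-Algebra.Coset"
    "Jordan_Normal_Form.Char_Poly"
begin

definition GL :: "nat \<Rightarrow> 'a::field mat monoid" where
  "GL n = units_of (ring_mat TYPE('a) n ())"

definition SL :: "nat \<Rightarrow> 'a::field mat set" where
  "SL n = {A \<in> carrier (GL n). Determinant.det A = 1}"

(* N(q;j), where q is the order of the finite field 'a *)
definition num_irred :: "'a::{field,finite} itself \<Rightarrow> nat \<Rightarrow> nat" where
  "num_irred _ j = card {f :: 'a poly. lead_coeff f = 1 \<and> irreducible f \<and> degree f = j \<and> poly.coeff f 0 \<noteq> 0}"

definition no_irred_factor_upto :: "nat \<Rightarrow> 'a::field poly \<Rightarrow> bool" where
  "no_irred_factor_upto t p \<longleftrightarrow> \<not> (\<exists>f. irreducible f \<and> f dvd p \<and> degree f \<le> t)"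

lemma group_GL: "group (GL n :: 'a::field mat monoid)"
proof -
  interpret ring "ring_mat TYPE('a) n ()" by (rule ring_mat)
  show ?thesis unfolding GL_def by (rule units_group)
qed

lemma carrier_GL: "carrier (GL n) = {A \<in> carrier_mat n n. Determinant.det A \<noteq> (0::'a::field)}"
  unfolding GL_def units_of_def
  using det_non_zero_imp_unit[of _ n]
  by (auto simp: Units_def ring_mat_def dest!: arg_cong[of _ _ Determinant.det] simp: det_mult)

lemma mult_GL [simp]: "A \<otimes>\<^bsub>GL n\<^esub> B = A * B"
  by (simp add: GL_def units_of_def ring_mat_def)

lemma one_GL [simp]: "\<one>\<^bsub>GL n\<^esub> = 1\<^sub>m n"
  by (simp add: GL_def units_of_def ring_mat_def)

lemma subgroup_SL: "subgroup (SL n) (GL n :: 'a::field mat monoid)"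
proof -
  interpret group "GL n :: 'a mat monoid" by (rule group_GL)
  show ?thesis
  proof (rule subgroupI)
    show "SL n \<noteq> ({} :: 'a mat set)"
      using one_closed by (auto simp: SL_def intro!: exI[of _ "1\<^sub>m n"])
  next
    fix A :: "'a mat" assume A: "A \<in> SL n"
    then have c: "A \<in> carrier (GL n)" by (simp add: SL_def)
    then have i: "inv\<^bsub>GL n\<^esub> A \<in> carrier (GL n)" by simp
    have "Determinant.det (inv\<^bsub>GL n\<^esub> A * A) = 1" using l_inv[OF c] by simp
    with A c i show "inv\<^bsub>GL n\<^esub> A \<in> SL n"
      by (auto simp: SL_def carrier_GL det_mult)
  qed (auto simp: SL_def carrier_GL det_mult)
qed

(* In particular the right cosets are also the left cosets. *)
lemma rcosets_SL:
  assumes "0 < n"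
  shows "rcosets\<^bsub>GL n\<^esub> SL n =
    {{A \<in> carrier_mat n n. Determinant.det A = d} |d :: 'a::field. d \<noteq> 0}"
proof -
  interpret group "GL n :: 'a mat monoid" by (rule group_GL)
  have coset: "SL n #>\<^bsub>GL n\<^esub> B = {A \<in> carrier_mat n n. Determinant.det A = Determinant.det B}"
    if B: "B \<in> carrier (GL n)" for B :: "'a mat"
  proof (intro equalityI subsetI)
    fix A assume "A \<in> SL n #>\<^bsub>GL n\<^esub> B"
    then obtain S where "S \<in> SL n" "A = S * B" by (auto simp: r_coset_def)
    with B show "A \<in> {A \<in> carrier_mat n n. Determinant.det A = Determinant.det B}"
      by (auto simp: SL_def carrier_GL det_mult)
  next
    fix A assume "A \<in> {A \<in> carrier_mat n n. Determinant.det A = Determinant.det B}"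
    then have dA: "Determinant.det A = Determinant.det B" and A: "A \<in> carrier (GL n)"
      using B by (auto simp: carrier_GL)
    let ?S = "A \<otimes>\<^bsub>GL n\<^esub> inv\<^bsub>GL n\<^esub> B"
    have S: "?S \<in> carrier (GL n)" using A B by blast
    have SB: "?S \<otimes>\<^bsub>GL n\<^esub> B = A" using A B by (simp only: m_assoc inv_closed l_inv r_one)
    then have "Determinant.det ?S * Determinant.det B = Determinant.det B"
      using S B dA det_mult[of ?S n B] by (simp add: carrier_GL)
    then have "?S \<in> SL n" using S B by (simp add: SL_def carrier_GL)
    then show "A \<in> SL n #>\<^bsub>GL n\<^esub> B"
      unfolding r_coset_def using SB by blast
  qed
  have "\<exists>B. B \<in> carrier (GL n) \<and> Determinant.det B = d" if "d \<noteq> 0" for d :: 'a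
  proof -
    let ?B = "multrow_mat n 0 d"
    have "Determinant.det ?B = d" using assms by (simp add: det_multrow_mat)
    then show ?thesis using that by (intro exI[of _ ?B]) (auto simp: carrier_GL)
  qed
  moreover have "Determinant.det B \<noteq> 0" if "B \<in> carrier (GL n)" for B :: "'a mat"
    using that by (simp add: carrier_GL)
  ultimately show ?thesis
    unfolding RCOSETS_def by (auto simp: coset)
qed

end

theory Submission imports Defs begin

text \<open>
  The proof is a method of moments. An invertible matrix \<open>A\<close> has no irreducible factor of degree
  at most \<open>t\<close> iff \<open>f(A)\<close> has trivial kernel for each of the finitely many monic irreducible \<open>f\<close>
  of degree at most \<open>t\<close> with nonzero constant term. With \<open>Q = q ^ degree f\<close>, the kernel of \<open>f(A)\<close>
  has \<open>Q ^ m\<close> elements, and a \<open>q\<close>-binomial identity writes the indicator of \<open>m = 0\<close> as the sum over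
  \<open>r\<close> of the falling products \<open>(Q ^ m - 1) (Q ^ m - Q) \<dots> (Q ^ m - Q ^ (r - 1))\<close>, with coefficients
  \<open>(- 1) ^ r / ((Q - 1) (Q ^ 2 - 1) \<dots> (Q ^ r - 1))\<close>. Multiplying over all \<open>f\<close>, the falling products
  count the embeddings of a fixed direct sum of companion matrices into \<open>A\<close>. The mean number of
  embeddings of a fixed invertible \<open>m \<times> m\<close> matrix is exactly 1 over every coset of \<open>SL\<close>, provided
  \<open>m < n\<close>. Hence the proportion converges to the product over \<open>f\<close> of the coefficient sums, and Euler's
  identity turns each of these into the product of the \<open>1 - 1 / Q ^ i\<close>.
\<close>

unbundle no vec_syntax

subsection \<open>Evaluating polynomials at matrices\<close>

text \<open>Kernels are measured by cardinality instead of rank, so that averaging over a coset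
  becomes a double count. The mean is exactly 1 because an embedded invertible block fixes only part
  of the matrix: as long as a complementary block of positive size remains, its determinant can be
  adjusted to that of the coset. Hence the strict inequality, and hence the same limit for every
  coset. The obstacle is the exchange of limit and sum. In size n the expansion runs over all
  multiplicities up to n, so it includes sums of companion matrices of dimension n and more, whose
  mean may differ from 1. These means are still at most q, and the coefficients decay faster than
  any geometric sequence, so they stay summable after multiplication by 2 to the dimension. The
  terms of dimension at least n then cost O(2 ^ (-n)) altogether. The condition on the constant term
  acts twice: x never divides the characteristic polynomial of an invertible matrix, and without x
  all companion matrices in play are invertible, as the exact mean requires.\<close>

definition poly_mat :: "'a::comm_ring_1 poly \<Rightarrow> 'a mat \<Rightarrow> 'a mat" where
  "poly_mat p A =
    fold_coeffs (\<lambda>a B. a \<cdot>\<^sub>m 1\<^sub>m (dim_row A) + A * B) p (0\<^sub>m (dim_row A) (dim_row A))"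

lemma poly_mat_0 [simp]: "A \<in> carrier_mat n n \<Longrightarrow> poly_mat 0 A = 0\<^sub>m n n"
  by (simp add: poly_mat_def)

lemma poly_mat_pCons:
  assumes "A \<in> carrier_mat n n"
  shows "poly_mat (pCons a p) A = a \<cdot>\<^sub>m 1\<^sub>m n + A * poly_mat p A"
\<comment> \<open>\<open>fold_coeffs\<close> has no step for \<open>pCons 0 0\<close>, which is the
  zero polynomial, so there both sides are compared directly.\<close>
proof (cases "p = 0 \<and> a = 0")
  case True
  then show ?thesis using assms by (auto simp: poly_mat_def)
next
  case False
  then show ?thesis
    using assms by (cases "p = 0") (auto simp: poly_mat_def fold_coeffs_pCons_coeff_not_0_eq
        fold_coeffs_pCons_not_0_0_eq)
qed

lemma poly_mat_carrier [simp]: "A \<in> carrier_mat n n \<Longrightarrow> poly_mat p A \<in> carrier_mat n n"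
  by (induction p) (auto simp: poly_mat_pCons)

lemma poly_mat_dim [simp]:
  "A \<in> carrier_mat n n \<Longrightarrow> dim_row (poly_mat p A) = n"
  "A \<in> carrier_mat n n \<Longrightarrow> dim_col (poly_mat p A) = n"
  by (metis carrier_matD poly_mat_carrier)+

lemma poly_mat_1 [simp]: "A \<in> carrier_mat n n \<Longrightarrow> poly_mat 1 A = 1\<^sub>m n"
  unfolding one_pCons by (auto simp: poly_mat_pCons)

lemma poly_mat_add:
  assumes A: "A \<in> carrier_mat n n"
  shows "poly_mat (p + q) A = poly_mat p A + poly_mat q A"
proof (induction p q rule: poly_induct2)
  case 0
  then show ?case using A by simp
next
  case (pCons a p b q)
  let ?P = "poly_mat p A" and ?Q = "poly_mat q A"
  have c: "?P \<in> carrier_mat n n" "?Q \<in> carrier_mat n n" using A by auto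
  have d: "A * (?P + ?Q) = A * ?P + A * ?Q"
    by (rule mult_add_distrib_mat[OF A c])
  show ?case using A c
    by (auto simp: poly_mat_pCons pCons d intro!: eq_matI simp: algebra_simps)
qed

lemma poly_mat_smult:
  assumes A: "A \<in> carrier_mat n n"
  shows "poly_mat (Polynomial.smult c p) A = c \<cdot>\<^sub>m poly_mat p A"
proof (induction p)
  case 0
  then show ?case using A by auto
next
  case (pCons a p)
  have c: "poly_mat p A \<in> carrier_mat n n" using A by auto
  show ?case using A c
    by (auto simp: poly_mat_pCons pCons mult_smult_distrib[OF A c] intro!: eq_matI simp: algebra_simps)
qed

lemma poly_mat_mult:
  assumes A: "A \<in> carrier_mat n n"
  shows "poly_mat (p * q) A = poly_mat p A * poly_mat q A"
proof (induction p)
  case 0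
  then show ?case using A by auto
next
  case (pCons a p)
  have c: "poly_mat p A \<in> carrier_mat n n" "poly_mat q A \<in> carrier_mat n n" using A by auto
  have "poly_mat (pCons a p * q) A = a \<cdot>\<^sub>m poly_mat q A + (0 \<cdot>\<^sub>m 1\<^sub>m n + A * (poly_mat p A * poly_mat q A))"
    using A by (simp add: poly_mat_add poly_mat_smult poly_mat_pCons pCons)
  also have "0 \<cdot>\<^sub>m 1\<^sub>m n + A * (poly_mat p A * poly_mat q A) = (A * poly_mat p A) * poly_mat q A"
    using A c by (auto simp: assoc_mult_mat[OF A c] intro!: eq_matI)
  also have "a \<cdot>\<^sub>m poly_mat q A = (a \<cdot>\<^sub>m 1\<^sub>m n) * poly_mat q A"
    using c by (simp add: mult_smult_assoc_mat[of "1\<^sub>m n" n n])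
  also have "(a \<cdot>\<^sub>m 1\<^sub>m n) * poly_mat q A + A * poly_mat p A * poly_mat q A
      = (a \<cdot>\<^sub>m 1\<^sub>m n + A * poly_mat p A) * poly_mat q A"
    by (rule add_mult_distrib_mat[symmetric, of _ n n]) (use A c in auto)
  finally show ?case using A by (simp add: poly_mat_pCons)
qed

text \<open>Commuting with the action of x means commuting with the action of every polynomial:
  \<open>X\<close> is a homomorphism of modules over the polynomial ring.\<close>

lemma poly_mat_intertwine:
  assumes A: "A \<in> carrier_mat n n" and M: "M \<in> carrier_mat m m" and X: "X \<in> carrier_mat n m"
    and eq: "A * X = X * M"
  shows "poly_mat p A * X = X * poly_mat p M"
proof (induction p)
  case 0
  then show ?case using A M X by auto
next
  case (pCons a p)
  have c: "poly_mat p A \<in> carrier_mat n n" "poly_mat p M \<in> carrier_mat m m" using A M by auto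
  have "poly_mat (pCons a p) A * X = (a \<cdot>\<^sub>m 1\<^sub>m n) * X + A * poly_mat p A * X"
    unfolding poly_mat_pCons[OF A] by (rule add_mult_distrib_mat[of _ n n]) (use A X c in auto)
  also have "A * poly_mat p A * X = A * (X * poly_mat p M)"
    using A X c by (simp add: assoc_mult_mat[of _ n n _ n _ m] pCons)
  also have "\<dots> = X * (M * poly_mat p M)"
    using A X c M by (simp add: assoc_mult_mat[symmetric, of _ n n _ m _ m] eq)
      (simp add: assoc_mult_mat[of _ n m _ m _ m])
  also have "(a \<cdot>\<^sub>m 1\<^sub>m n) * X = X * (a \<cdot>\<^sub>m 1\<^sub>m m)"
    using X by (simp add: mult_smult_assoc_mat[of "1\<^sub>m n" n n] mult_smult_distrib[OF X one_carrier_mat])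
  also have "X * (a \<cdot>\<^sub>m 1\<^sub>m m) + X * (M * poly_mat p M) = X * (a \<cdot>\<^sub>m 1\<^sub>m m + M * poly_mat p M)"
    by (rule mult_add_distrib_mat[symmetric, of _ n m]) (use X M c in auto)
  finally show ?case using M by (simp add: poly_mat_pCons)
qed

lemma poly_mat_diag:
  assumes A: "A \<in> carrier_mat n n" and M: "M \<in> carrier_mat m m"
  shows "poly_mat p (four_block_mat A (0\<^sub>m n m) (0\<^sub>m m n) M)
    = four_block_mat (poly_mat p A) (0\<^sub>m n m) (0\<^sub>m m n) (poly_mat p M)"
proof (induction p)
  case 0
  have "four_block_mat A (0\<^sub>m n m) (0\<^sub>m m n) M \<in> carrier_mat (n + m) (n + m)"
    using A M by auto
  then show ?case using A M by auto
next
  case (pCons a p)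
  have c: "poly_mat p A \<in> carrier_mat n n" "poly_mat p M \<in> carrier_mat m m" using A M by auto
  have F: "four_block_mat A (0\<^sub>m n m) (0\<^sub>m m n) M \<in> carrier_mat (n + m) (n + m)"
    using A M by auto
  show ?case
    unfolding poly_mat_pCons[OF F] poly_mat_pCons[OF A] poly_mat_pCons[OF M] pCons.IH
    by (subst mult_four_block_mat[of _ n n _ m _ m _ _ n _ m])
       (use A M c in \<open>auto intro!: eq_matI\<close>)
qed

lemma mult_unit_vec:
  fixes X :: "'a::comm_ring_1 mat"
  assumes "X \<in> carrier_mat n m" "j < m"
  shows "X *\<^sub>v unit_vec m j = col X j"
  using assms by (auto intro!: eq_vecI)

lemma poly_mat_pCons_0_vec:
  assumes A: "A \<in> carrier_mat n n" and v: "v \<in> carrier_vec n"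
  shows "poly_mat (pCons 0 p) A *\<^sub>v v = A *\<^sub>v (poly_mat p A *\<^sub>v v)"
proof -
  have c: "poly_mat p A \<in> carrier_mat n n" using A by simp
  have "0 \<cdot>\<^sub>m 1\<^sub>m n + A * poly_mat p A = A * poly_mat p A" using A c by (auto intro!: eq_matI)
  then show ?thesis by (simp add: poly_mat_pCons[OF A] assoc_mult_mat_vec[OF A c v])
qed

lemma mult_mat_zero_vec:
  fixes X :: "'a::semiring_0 mat"
  assumes "X \<in> carrier_mat n m"
  shows "X *\<^sub>v 0\<^sub>v m = 0\<^sub>v n"
  using assms by (auto intro!: eq_vecI)

subsection \<open>Companion matrices\<close>

text \<open>The columns are v, A v, ..., A^(d-1) v. If f is monic of degree d and f(A) v = 0, this
  is the matrix of the module map from K[x]/(f) that sends 1 to v.\<close>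

definition krylov :: "'a::comm_ring_1 mat \<Rightarrow> 'a vec \<Rightarrow> nat \<Rightarrow> 'a mat" where
  "krylov A v d = mat (dim_row A) d (\<lambda>(i,j). (poly_mat (monom 1 j) A *\<^sub>v v) $ i)"

text \<open>Reads a vector as an element of K[x]/(f) in the basis 1, x, ..., x^(d-1), so that
  applying \<open>krylov A v d\<close> to it becomes evaluating a polynomial at \<open>A\<close> and
  applying it to \<open>v\<close>.\<close>

definition vec_poly :: "nat \<Rightarrow> 'a::comm_ring_1 vec \<Rightarrow> 'a poly" where
  "vec_poly d y = (\<Sum>i<d. monom (y $ i) i)"

lemma coeff_vec_poly: "coeff (vec_poly d y) i = (if i < d then y $ i else 0)"
  by (auto simp: vec_poly_def coeff_sum coeff_monom)

lemma krylov_carrier [simp]: "A \<in> carrier_mat n n \<Longrightarrow> krylov A v d \<in> carrier_mat n d"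
  by (auto simp: krylov_def)

lemma col_krylov:
  assumes "A \<in> carrier_mat n n" "v \<in> carrier_vec n" "j < d"
  shows "col (krylov A v d) j = poly_mat (monom 1 j) A *\<^sub>v v"
  using assms by (auto simp: krylov_def intro!: eq_vecI)

lemma poly_mat_sum_monom_vec:
  assumes A: "A \<in> carrier_mat n n" and v: "v \<in> carrier_vec n" and k: "k < n" and "finite S"
  shows "(poly_mat (\<Sum>i\<in>S. monom (c i) i) A *\<^sub>v v) $ k
    = (\<Sum>i\<in>S. c i * (poly_mat (monom 1 i) A *\<^sub>v v) $ k)"
  using \<open>finite S\<close>
proof induction
  case empty
  then show ?case using A v k by (auto)
next
  case (insert i S)
  have "monom (c i) i = Polynomial.smult (c i) (monom 1 i)" by (simp add: smult_monom)
  then have "(poly_mat (monom (c i) i) A *\<^sub>v v) $ k = c i * (poly_mat (monom 1 i) A *\<^sub>v v) $ k"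
    using A v k poly_mat_carrier[OF A, of "monom 1 i"] by (simp add: poly_mat_smult)
  then show ?case
    using insert A v k
    by (simp add: poly_mat_add add_mult_distrib_mat_vec[of _ n n])
qed

lemma krylov_mult_vec:
  assumes A: "A \<in> carrier_mat n n" and v: "v \<in> carrier_vec n" and y: "y \<in> carrier_vec d"
  shows "krylov A v d *\<^sub>v y = poly_mat (vec_poly d y) A *\<^sub>v v"
proof (rule eq_vecI)
  fix k assume "k < dim_vec (poly_mat (vec_poly d y) A *\<^sub>v v)"
  then have k: "k < n" using A by auto
  show "(krylov A v d *\<^sub>v y) $ k = (poly_mat (vec_poly d y) A *\<^sub>v v) $ k"
    unfolding vec_poly_def poly_mat_sum_monom_vec[OF A v k finite_lessThan]
    using A y k by (auto simp: scalar_prod_def krylov_def lessThan_atLeast0 mult.commute simp del: index_mult_mat_vec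
        simp: index_mult_mat_vec[of k "mat _ _ _"] intro!: sum.cong)
qed (use A in \<open>auto simp: krylov_def\<close>)

text \<open>For monic f, multiplication by x on K[x]/(f) in the basis of powers of x. The first
  basis vector is cyclic.\<close>

definition companion :: "'a::comm_ring_1 poly \<Rightarrow> 'a mat" where
  "companion f = mat (degree f) (degree f)
    (\<lambda>(i,j). if Suc j < degree f then (if i = Suc j then 1 else 0) else - coeff f i)"

lemma companion_carrier [simp]: "companion f \<in> carrier_mat (degree f) (degree f)"
  by (simp add: companion_def)

lemma companion_dim [simp]: "dim_row (companion f) = degree f" "dim_col (companion f) = degree f"
  by (simp_all add: companion_def)

lemma vec_poly_coeffs:
  assumes "lead_coeff f = 1"
  shows "f = monom 1 (degree f) + vec_poly (degree f) (vec (degree f) (coeff f))"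
  using assms by (auto intro!: poly_eqI simp: coeff_vec_poly coeff_monom coeff_eq_0)

text \<open>The relation f(A) v = 0 is exactly what makes the map x^j to A^j v well defined on
  K[x]/(f).\<close>

lemma krylov_intertwine:
  assumes A: "A \<in> carrier_mat n n" and v: "v \<in> carrier_vec n"
    and f: "lead_coeff f = 1" and 0: "poly_mat f A *\<^sub>v v = 0\<^sub>v n"
  shows "A * krylov A v (degree f) = krylov A v (degree f) * companion f"
proof (rule mat_col_eqI)
  let ?d = "degree f" let ?K = "krylov A v (degree f)" and ?C = "companion f"
  have K: "?K \<in> carrier_mat n ?d" using A by simp
  fix j assume "j < dim_col (?K * ?C)"
  then have j: "j < ?d" by (simp add: companion_def)
  have "col (A * ?K) j = poly_mat (monom 1 (Suc j)) A *\<^sub>v v"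
    using A v j K by (simp add: col_mult2[OF A K] col_krylov monom_Suc poly_mat_pCons_0_vec)
  also have "\<dots> = ?K *\<^sub>v col ?C j"
  proof (cases "Suc j < ?d")
    case True
    then have "vec_poly ?d (col ?C j) = monom 1 (Suc j)"
      by (auto intro!: poly_eqI simp: coeff_vec_poly coeff_monom companion_def)
    then show ?thesis using A v by (subst krylov_mult_vec[OF A v]) (auto simp: companion_def intro!: carrier_vecI)
  next
    \<comment> \<open>Only the last column sees f: there x^d is rewritten as x^d - f, whose
      coefficients form the last column of the companion matrix.\<close>
    case False
    then have d: "?d = Suc j" using j by simp
    have "vec_poly ?d (col ?C j) = - vec_poly ?d (vec ?d (coeff f))"
      using j False by (auto intro!: poly_eqI simp: coeff_vec_poly coeff_monom companion_def)
    then have "monom 1 (Suc j) = f + vec_poly ?d (col ?C j)"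
      using vec_poly_coeffs[OF f] d by (simp add: eq_diff_eq)
    then have "poly_mat (monom 1 (Suc j)) A *\<^sub>v v
        = poly_mat f A *\<^sub>v v + poly_mat (vec_poly ?d (col ?C j)) A *\<^sub>v v"
      using A v by (simp add: poly_mat_add add_mult_distrib_mat_vec[of _ n n])
    also have "\<dots> = poly_mat (vec_poly ?d (col ?C j)) A *\<^sub>v v"
      using A v 0 by (intro eq_vecI) auto
    finally show ?thesis by (subst krylov_mult_vec[OF A v]) (auto simp: companion_def intro!: carrier_vecI)
  qed
  also have "\<dots> = col (?K * ?C) j"
    by (rule col_mult2[OF K companion_carrier j, symmetric])
  finally show "col (A * ?K) j = col (?K * ?C) j" .
qed (use A in \<open>auto simp: krylov_def companion_def\<close>)

lemma poly_mat_monom_companion: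
  assumes "j < degree f"
  shows "poly_mat (monom 1 j) (companion f) *\<^sub>v unit_vec (degree f) 0 = unit_vec (degree f) j"
  using assms
proof (induction j)
  case 0
  then show ?case by (simp add: monom_0 one_pCons[symmetric] poly_mat_1[OF companion_carrier])
next
  case (Suc j)
  then have "poly_mat (monom 1 (Suc j)) (companion f) *\<^sub>v unit_vec (degree f) 0
      = companion f *\<^sub>v unit_vec (degree f) j"
    unfolding monom_Suc by (subst poly_mat_pCons_0_vec[OF companion_carrier]) auto
  also have "\<dots> = unit_vec (degree f) (Suc j)"
    using Suc.prems by (subst mult_unit_vec[OF companion_carrier]) (auto simp: companion_def intro!: eq_vecI)
  finally show ?case .
qed

lemma krylov_companion:
  "krylov (companion f) (unit_vec (degree f) 0) (degree f) = 1\<^sub>m (degree f)"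
  by (rule mat_col_eqI)
    (auto simp: col_krylov[OF companion_carrier] poly_mat_monom_companion, auto simp: krylov_def companion_def)

lemma poly_mat_companion_unit_vec:
  assumes f: "lead_coeff f = 1" and d: "degree f > 0"
  shows "poly_mat f (companion f) *\<^sub>v unit_vec (degree f) 0 = 0\<^sub>v (degree f)"
proof -
  let ?d = "degree f" let ?C = "companion f"
  let ?c = "vec ?d (coeff f)"
  have C: "?C \<in> carrier_mat ?d ?d" by simp
  obtain k where k: "?d = Suc k" using d by (cases ?d) auto
  have "poly_mat (monom 1 ?d) ?C *\<^sub>v unit_vec ?d 0 = ?C *\<^sub>v (poly_mat (monom 1 k) ?C *\<^sub>v unit_vec ?d 0)"
    by (subst k, subst monom_Suc, rule poly_mat_pCons_0_vec[OF C]) auto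
  also have "\<dots> = - ?c"
    using k by (subst poly_mat_monom_companion) (auto simp: mult_unit_vec[OF C] companion_def intro!: eq_vecI)
  finally have 1: "poly_mat (monom 1 ?d) ?C *\<^sub>v unit_vec ?d 0 = - ?c" .
  have 2: "poly_mat (vec_poly ?d ?c) ?C *\<^sub>v unit_vec ?d 0 = ?c"
    using krylov_mult_vec[OF C, of "unit_vec ?d 0" ?c ?d] by (simp add: krylov_companion)
  have "poly_mat f ?C *\<^sub>v unit_vec ?d 0
      = poly_mat (monom 1 ?d) ?C *\<^sub>v unit_vec ?d 0 + poly_mat (vec_poly ?d ?c) ?C *\<^sub>v unit_vec ?d 0"
    by (subst vec_poly_coeffs[OF f], subst poly_mat_add[OF C], rule add_mult_distrib_mat_vec[of _ ?d ?d])
      (use poly_mat_carrier[OF C] in auto)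
  then show ?thesis unfolding 1 2 by (auto intro!: eq_vecI)
qed

text \<open>f(C) kills the cyclic vector and commutes with the powers of C, which carry the cyclic
  vector to every standard basis vector.\<close>

lemma poly_mat_companion:
  assumes f: "lead_coeff f = 1" and d: "degree f > 0"
  shows "poly_mat f (companion f) = 0\<^sub>m (degree f) (degree f)"
proof (rule mat_col_eqI)
  let ?d = "degree f" let ?C = "companion f"
  have C: "?C \<in> carrier_mat ?d ?d" by simp
  have F: "poly_mat p ?C \<in> carrier_mat ?d ?d" for p using C by simp
  fix j assume "j < dim_col (0\<^sub>m ?d ?d :: 'a mat)"
  then have j: "j < ?d" by simp
  have "col (poly_mat f ?C) j = poly_mat f ?C *\<^sub>v (poly_mat (monom 1 j) ?C *\<^sub>v unit_vec ?d 0)"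
    unfolding poly_mat_monom_companion[OF j] mult_unit_vec[OF F j] ..
  also have "\<dots> = poly_mat (monom 1 j) ?C *\<^sub>v (poly_mat f ?C *\<^sub>v unit_vec ?d 0)"
    by (simp add: assoc_mult_mat_vec[OF F F, symmetric] poly_mat_mult[OF C, symmetric] mult.commute)
  also have "\<dots> = 0\<^sub>v ?d"
    by (simp add: poly_mat_companion_unit_vec[OF f d] mult_mat_zero_vec[OF F])
  finally show "col (poly_mat f ?C) j = col (0\<^sub>m ?d ?d) j" using j by simp
qed (use poly_mat_carrier[OF companion_carrier[of f], of f] in auto)

text \<open>A module homomorphism out of a cyclic module is determined by the image of its
  generator.\<close>

lemma krylov_unique:
  assumes A: "A \<in> carrier_mat n n" and X: "X \<in> carrier_mat n (degree f)"
    and eq: "A * X = X * companion f"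
  shows "X = krylov A (X *\<^sub>v unit_vec (degree f) 0) (degree f)"
proof (rule mat_col_eqI)
  let ?d = "degree f" let ?C = "companion f"
  fix j assume "j < dim_col (krylov A (X *\<^sub>v unit_vec ?d 0) ?d)"
  then have j: "j < ?d" by (simp add: krylov_def)
  have v: "X *\<^sub>v unit_vec ?d 0 \<in> carrier_vec n" using X by auto
  have PA: "poly_mat (monom 1 j) A \<in> carrier_mat n n" using A by simp
  have PC: "poly_mat (monom 1 j) ?C \<in> carrier_mat ?d ?d" by (rule poly_mat_carrier) simp
  have "col (krylov A (X *\<^sub>v unit_vec ?d 0) ?d) j = (poly_mat (monom 1 j) A * X) *\<^sub>v unit_vec ?d 0"
    by (simp add: col_krylov[OF A v j] assoc_mult_mat_vec[OF PA X])
  also have "\<dots> = X *\<^sub>v (poly_mat (monom 1 j) ?C *\<^sub>v unit_vec ?d 0)"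
    by (simp add: poly_mat_intertwine[OF A companion_carrier X eq] assoc_mult_mat_vec[OF X PC])
  also have "\<dots> = col X j"
    by (simp add: poly_mat_monom_companion[OF j] mult_unit_vec[OF X j])
  finally show "col X j = col (krylov A (X *\<^sub>v unit_vec ?d 0) ?d) j" by simp
qed (use A X in \<open>auto simp: krylov_def\<close>)

section \<open>Bezout identity and the action of coprime polynomials on kernels\<close>

lemma irreducible_poly_bezout:
  fixes f p :: "'a::field poly"
  assumes f: "irreducible f" and p: "\<not> f dvd p"
  obtains a b where "a * p + b * f = 1"
proof -
  \<comment> \<open>The ideal generated by p and f; a nonzero element g of least degree divides all
    its elements, by division with remainder.\<close>
  define S where "S = {a * p + b * f | a b. True}"
  have S_lin: "u * x + v * y \<in> S" if "x \<in> S" "y \<in> S" for u v x y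
  proof -
    from that obtain a b c d where xy: "x = a * p + b * f" "y = c * p + d * f"
      unfolding S_def by blast
    have "u * x + v * y = (u * a + v * c) * p + (u * b + v * d) * f"
      unfolding xy by (simp add: algebra_simps)
    then show ?thesis unfolding S_def by blast
  qed
  have "f = 0 * p + 1 * f" "p = 1 * p + 0 * f" by simp_all
  then have fS: "f \<in> S" and pS: "p \<in> S" unfolding S_def by blast+
  have "f \<noteq> 0" using f by auto
  then obtain g where g: "g \<in> S" "g \<noteq> 0" and min: "\<And>h. h \<in> S \<Longrightarrow> h \<noteq> 0 \<Longrightarrow> degree g \<le> degree h"
    using ex_has_least_nat[of "\<lambda>g. g \<in> S \<and> g \<noteq> 0" f degree] fS by blast
  have g_dvd: "g dvd h" if "h \<in> S" for h
  proof -
    have "h mod g = 1 * h + (- (h div g)) * g" by (simp add: minus_mult_div_eq_mod [symmetric] algebra_simps)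
    then have "h mod g \<in> S" using S_lin[OF that g(1), of 1 "- (h div g)"] by simp
    then have "h mod g = 0" using min[of "h mod g"] degree_mod_less[of g h] g(2) by fastforce
    then show ?thesis by auto
  qed
  from g_dvd[OF fS] obtain h where h: "f = g * h" by (elim dvdE)
  \<comment> \<open>If the cofactor were a unit, f would divide g and therefore p. So g itself must
    be the unit.\<close>
  have "\<not> h dvd 1"
  proof
    assume "h dvd 1"
    then obtain k where "1 = h * k" by (elim dvdE)
    then have "f * k = g" using h by (simp add: mult.assoc)
    then show False using p dvd_trans[of f g p] g_dvd[OF pS] by auto
  qed
  then have "g dvd 1" using irreducibleD[OF f h] by auto
  then obtain k where "1 = g * k" by (elim dvdE)
  then have "1 \<in> S" using S_lin[OF g(1) g(1), of k 0] by (simp add: mult.commute)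
  then show ?thesis using that unfolding S_def by auto
qed

lemma irreducible_poly_degree_pos:
  fixes f :: "'a::field poly"
  assumes "irreducible f"
  shows "0 < degree f"
  using assms is_unit_iff_degree[of f] by (auto simp: irreducible_def)

text \<open>A Bezout coefficient of p modulo f inverts p(A) wherever f(A) vanishes. It depends on f
  and p alone, hence the quantifiers over matrices and vectors sit inside.\<close>

lemma poly_mat_invertible_on_kernel:
  fixes f p :: "'a::field poly"
  assumes f: "irreducible f" and p: "\<not> f dvd p"
  obtains a where "\<And>n A v. A \<in> carrier_mat n n \<Longrightarrow> v \<in> carrier_vec n \<Longrightarrow> poly_mat f A *\<^sub>v v = 0\<^sub>v n
    \<Longrightarrow> poly_mat a A *\<^sub>v (poly_mat p A *\<^sub>v v) = v"
proof -
  from irreducible_poly_bezout[OF f p] obtain a b where ab: "a * p + b * f = 1" .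
  have "poly_mat a A *\<^sub>v (poly_mat p A *\<^sub>v v) = v"
    if A: "A \<in> carrier_mat n n" and v: "v \<in> carrier_vec n" and 0: "poly_mat f A *\<^sub>v v = 0\<^sub>v n" for n A v
  proof -
    have P: "poly_mat q A \<in> carrier_mat n n" for q using A by simp
    have "v = poly_mat (a * p + b * f) A *\<^sub>v v" unfolding ab using A v by simp
    also have "\<dots> = poly_mat a A *\<^sub>v (poly_mat p A *\<^sub>v v) + poly_mat b A *\<^sub>v (poly_mat f A *\<^sub>v v)"
      unfolding poly_mat_add[OF A] poly_mat_mult[OF A]
      using add_mult_distrib_mat_vec[OF mult_carrier_mat[OF P P] mult_carrier_mat[OF P P] v]
      by (simp add: assoc_mult_mat_vec[OF P P v])
    also have "\<dots> = poly_mat a A *\<^sub>v (poly_mat p A *\<^sub>v v)"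
      unfolding 0 mult_mat_zero_vec[OF P]
      using right_zero_vec[OF mult_mat_vec_carrier[OF P mult_mat_vec_carrier[OF P v]]] .
    finally show ?thesis by simp
  qed
  then show ?thesis using that by blast
qed

subsection \<open>Embeddings of companion matrices\<close>

lemma finite_card_carrier_vec:
  shows "finite (carrier_vec n :: 'a::finite vec set)"
    and "card (carrier_vec n :: 'a vec set) = CARD('a) ^ n"
proof -
  have "bij_betw (\<lambda>v. \<lambda>i\<in>{..<n}. v $ i) (carrier_vec n :: 'a vec set) (PiE {..<n} (\<lambda>_. UNIV))"
    by (rule bij_betwI[where g = "vec n"]) (auto simp: fun_eq_iff PiE_def extensional_def intro!: eq_vecI)
  then show "finite (carrier_vec n :: 'a vec set)" "card (carrier_vec n :: 'a vec set) = CARD('a) ^ n"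
    by (auto simp: bij_betw_finite bij_betw_same_card card_PiE intro!: finite_PiE)
qed

lemma finite_carrier_mat [simp]: "finite (carrier_mat n m :: 'a::finite mat set)"
proof -
  have "(carrier_mat n m :: 'a mat set) \<subseteq> mat n m ` (PiE ({..<n} \<times> {..<m}) (\<lambda>_. UNIV))"
  proof
    fix X :: "'a mat" assume "X \<in> carrier_mat n m"
    then have "X = mat n m (\<lambda>ij\<in>{..<n} \<times> {..<m}. X $$ ij)" by (auto intro!: eq_matI)
    then show "X \<in> mat n m ` (PiE ({..<n} \<times> {..<m}) (\<lambda>_. UNIV))"
      by (intro image_eqI[where f = "mat n m" and x = "\<lambda>ij\<in>{..<n} \<times> {..<m}. X $$ ij"]) auto
  qed
  then show ?thesis by (rule finite_subset) (auto intro!: finite_imageI finite_PiE)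
qed

definition poly_kernel :: "'a::comm_ring_1 poly \<Rightarrow> 'a mat \<Rightarrow> 'a vec set" where
  "poly_kernel p A = {v \<in> carrier_vec (dim_row A). poly_mat p A *\<^sub>v v = 0\<^sub>v (dim_row A)}"

lemma finite_poly_kernel [simp]: "finite (poly_kernel p A :: 'a::{finite,comm_ring_1} vec set)"
  by (rule finite_subset[OF _ finite_card_carrier_vec(1)]) (auto simp: poly_kernel_def)

definition inj_mat :: "'a::comm_ring_1 mat \<Rightarrow> bool" where
  "inj_mat X \<longleftrightarrow> (\<forall>v\<in>carrier_vec (dim_col X). X *\<^sub>v v = 0\<^sub>v (dim_row X) \<longrightarrow> v = 0\<^sub>v (dim_col X))"

lemma inj_matD:
  "inj_mat X \<Longrightarrow> X \<in> carrier_mat n m \<Longrightarrow> v \<in> carrier_vec m \<Longrightarrow> X *\<^sub>v v = 0\<^sub>v n \<Longrightarrow> v = 0\<^sub>v m"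
  by (auto simp: inj_mat_def)

lemma inj_matI:
  "X \<in> carrier_mat n m \<Longrightarrow> (\<And>v. v \<in> carrier_vec m \<Longrightarrow> X *\<^sub>v v = 0\<^sub>v n \<Longrightarrow> v = 0\<^sub>v m) \<Longrightarrow> inj_mat X"
  by (auto simp: inj_mat_def)

lemma inj_mat_inj_on:
  assumes "inj_mat X" and X: "X \<in> carrier_mat n m"
  shows "inj_on (\<lambda>v. X *\<^sub>v v) (carrier_vec m)"
proof (rule inj_onI)
  fix u v assume u: "u \<in> carrier_vec m" and v: "v \<in> carrier_vec m" and eq: "X *\<^sub>v u = X *\<^sub>v v"
  have "X *\<^sub>v (u - v) = 0\<^sub>v n"
    using X u v eq by (simp add: mult_minus_distrib_mat_vec[OF X u v])
  then have "u - v = 0\<^sub>v m" using inj_matD[OF assms, of "u - v"] u v by simp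
  then have "(u - v) $ i = 0" if "i < m" for i using that by simp
  then show "u = v" using u v by (intro eq_vecI) auto
qed

text \<open>Over a finite field the dimension bound is the pigeonhole principle: q^m distinct images
  among q^n vectors.\<close>

lemma inj_mat_dim_le:
  assumes "inj_mat X" and X: "(X :: 'a::{field,finite} mat) \<in> carrier_mat n m"
  shows "m \<le> n"
proof -
  have "card ((\<lambda>v. X *\<^sub>v v) ` carrier_vec m) = CARD('a) ^ m"
    by (simp add: card_image[OF inj_mat_inj_on[OF assms]] finite_card_carrier_vec)
  moreover have "card ((\<lambda>v. X *\<^sub>v v) ` carrier_vec m) \<le> card (carrier_vec n :: 'a vec set)"
    by (rule card_mono) (use X in \<open>auto simp: finite_card_carrier_vec\<close>)
  ultimately have "CARD('a) ^ m \<le> CARD('a) ^ n" by (simp add: finite_card_carrier_vec)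
  moreover have "1 < CARD('a)"
    using card_mono[of "UNIV :: 'a set" "{0,1}"] by simp
  ultimately show ?thesis by simp
qed

text \<open>Viewing \<open>A\<close> and \<open>M\<close> as modules over the polynomial ring, these are the injective
  module homomorphisms from \<open>M\<close> to \<open>A\<close>.\<close>

definition embeddings :: "'a::comm_ring_1 mat \<Rightarrow> 'a mat \<Rightarrow> 'a mat set" where
  "embeddings A M = {X \<in> carrier_mat (dim_row A) (dim_row M). A * X = X * M \<and> inj_mat X}"

lemma finite_embeddings [simp]: "finite (embeddings A M :: 'a::{finite,comm_ring_1} mat set)"
  by (rule finite_subset[OF _ finite_carrier_mat]) (auto simp: embeddings_def)

section \<open>Matrices with two blocks of columns\<close>

definition hcat :: "'a::zero mat \<Rightarrow> 'a mat \<Rightarrow> 'a mat" where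
  "hcat X Y = mat (dim_row X) (dim_col X + dim_col Y)
    (\<lambda>(i,j). if j < dim_col X then X $$ (i,j) else Y $$ (i, j - dim_col X))"

text \<open>With lower blocks of height 0, the multiplication laws for block matrices become
  available.\<close>

lemma hcat_four_block:
  assumes "X \<in> carrier_mat n d" "Y \<in> carrier_mat n m"
  shows "hcat X Y = four_block_mat X Y (0\<^sub>m 0 d) (0\<^sub>m 0 m)"
  using assms by (auto simp: hcat_def intro!: eq_matI)

lemma hcat_carrier [simp]:
  "X \<in> carrier_mat n d \<Longrightarrow> Y \<in> carrier_mat n m \<Longrightarrow> hcat X Y \<in> carrier_mat n (d + m)"
  by (auto simp: hcat_def)

lemma hcat_inject:
  assumes "X \<in> carrier_mat n d" "Y \<in> carrier_mat n m" "X' \<in> carrier_mat n d" "Y' \<in> carrier_mat n m"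
  shows "hcat X Y = hcat X' Y' \<longleftrightarrow> X = X' \<and> Y = Y'"
proof
  assume eq: "hcat X Y = hcat X' Y'"
  have "X $$ (i,j) = X' $$ (i,j)" if "i < n" "j < d" for i j
    using arg_cong[OF eq, of "\<lambda>Z. Z $$ (i,j)"] assms that by (auto simp: hcat_def)
  moreover have "Y $$ (i,j) = Y' $$ (i,j)" if "i < n" "j < m" for i j
    using arg_cong[OF eq, of "\<lambda>Z. Z $$ (i,d+j)"] assms that by (auto simp: hcat_def)
  ultimately show "X = X' \<and> Y = Y'" using assms by (auto intro!: eq_matI)
qed simp

lemma hcat_cases:
  assumes "Z \<in> carrier_mat n (d + m)"
  obtains X Y where "X \<in> carrier_mat n d" "Y \<in> carrier_mat n m" "Z = hcat X Y"
proof
  show "Z = hcat (mat n d (\<lambda>ij. Z $$ ij)) (mat n m (\<lambda>(i,j). Z $$ (i, d + j)))"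
    using assms by (auto simp: hcat_def intro!: eq_matI)
qed auto

lemma mult_hcat:
  assumes A: "A \<in> carrier_mat k n" and X: "X \<in> carrier_mat n d" and Y: "Y \<in> carrier_mat n m"
  shows "A * hcat X Y = hcat (A * X) (A * Y)"
proof (rule mat_col_eqI)
  fix j assume "j < dim_col (hcat (A * X) (A * Y))"
  then have j: "j < d + m" using X Y by (simp add: hcat_def)
  have "col (hcat X Y) j = (if j < d then col X j else col Y (j - d))"
    using X Y j by (auto simp: hcat_def intro!: eq_vecI)
  then show "col (A * hcat X Y) j = col (hcat (A * X) (A * Y)) j"
    using A X Y j by (auto simp: col_mult2[OF A hcat_carrier[OF X Y]] hcat_def intro!: eq_vecI)
qed (use A X Y in \<open>auto simp: hcat_def\<close>)

lemma hcat_mult_diag: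
  fixes X Y :: "'a::comm_ring_1 mat"
  assumes X: "X \<in> carrier_mat n d" and Y: "Y \<in> carrier_mat n m"
    and C: "C \<in> carrier_mat d d" and M: "M \<in> carrier_mat m m"
  shows "hcat X Y * four_block_mat C (0\<^sub>m d m) (0\<^sub>m m d) M = hcat (X * C) (Y * M)"
  unfolding hcat_four_block[OF X Y] hcat_four_block[OF mult_carrier_mat[OF X C] mult_carrier_mat[OF Y M]]
  by (subst mult_four_block_mat[OF X Y _ _ C _ _ M]) (use assms in \<open>auto intro!: cong_four_block_mat\<close>)

lemma hcat_mult_vec:
  fixes X Y :: "'a::comm_ring_1 mat"
  assumes X: "X \<in> carrier_mat n d" and Y: "Y \<in> carrier_mat n m"
    and a: "a \<in> carrier_vec d" and b: "b \<in> carrier_vec m"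
  shows "hcat X Y *\<^sub>v (a @\<^sub>v b) = X *\<^sub>v a + Y *\<^sub>v b"
proof -
  have "hcat X Y *\<^sub>v (a @\<^sub>v b) = (X *\<^sub>v a + Y *\<^sub>v b) @\<^sub>v (0\<^sub>m 0 d *\<^sub>v a + 0\<^sub>m 0 m *\<^sub>v b)"
    unfolding hcat_four_block[OF X Y] by (rule four_block_mat_mult_vec) (use assms in auto)
  then show ?thesis using X Y by (auto intro!: eq_vecI)
qed

text \<open>Extending an embedding \<open>X\<close> of \<open>M\<close> by a block for \<open>companion f\<close> amounts to choosing the image \<open>v\<close>
  of the cyclic vector: \<open>v\<close> is killed by \<open>f\<close> and, as \<open>f\<close> is irreducible, injectivity only
  requires that \<open>v\<close> is not in the column space of \<open>X\<close>.\<close>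

lemma card_embeddings_companion_sum:
  fixes A M :: "'a::{field,finite} mat"
  assumes A: "A \<in> carrier_mat n n" and M: "M \<in> carrier_mat m m"
    and f: "irreducible f" "lead_coeff f = 1"
  shows "int (card (embeddings A
      (four_block_mat (companion f) (0\<^sub>m (degree f) m) (0\<^sub>m m (degree f)) M)))
    = int (card (embeddings A M)) * (int (card (poly_kernel f A)) - int (card (poly_kernel f M)))"
proof -
  let ?d = "degree f" let ?C = "companion f"
  let ?D = "four_block_mat ?C (0\<^sub>m ?d m) (0\<^sub>m m ?d) M"
  have C: "?C \<in> carrier_mat ?d ?d" by simp
  have D: "?D \<in> carrier_mat (?d + m) (?d + m)" using C M by auto
  have d: "0 < ?d" by (rule irreducible_poly_degree_pos[OF f(1)])
  have P: "poly_mat p A \<in> carrier_mat n n" for p using A by simp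
  have Q: "poly_mat p M \<in> carrier_mat m m" for p using M by simp
  define R where "R X = poly_kernel f A - (\<lambda>y. X *\<^sub>v y) ` poly_kernel f M" for X
  have inter: "poly_mat p A *\<^sub>v (X *\<^sub>v y) = X *\<^sub>v (poly_mat p M *\<^sub>v y)"
    if X: "X \<in> embeddings A M" and y: "y \<in> carrier_vec m" for p X y
  proof -
    have X: "X \<in> carrier_mat n m" and eq: "A * X = X * M" using X A M by (auto simp: embeddings_def)
    show ?thesis using poly_mat_intertwine[OF A M X eq, of p]
      by (simp add: assoc_mult_mat_vec[OF P X y, symmetric] assoc_mult_mat_vec[OF X Q y, symmetric])
  qed
  \<comment> \<open>\<open>R X\<close> removes only the image of the kernel of f(M), yet this
    excludes the whole column space: if X y is killed by f(A), then X f(M) y = 0, and injectivity of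
    X puts y into that kernel.\<close>
  have R_notin: "v \<notin> (\<lambda>y. X *\<^sub>v y) ` carrier_vec m" if X: "X \<in> embeddings A M" and v: "v \<in> R X" for X v
  proof
    assume "v \<in> (\<lambda>y. X *\<^sub>v y) ` carrier_vec m"
    then obtain y where y: "y \<in> carrier_vec m" "v = X *\<^sub>v y" by auto
    have Xc: "X \<in> carrier_mat n m" "inj_mat X" using X A M by (auto simp: embeddings_def)
    have "X *\<^sub>v (poly_mat f M *\<^sub>v y) = 0\<^sub>v n"
      using v A inter[OF X y(1), of f] y(2) by (simp add: R_def poly_kernel_def)
    then have "poly_mat f M *\<^sub>v y = 0\<^sub>v m"
      using inj_matD[OF Xc(2,1)] mult_mat_vec_carrier[OF Q y(1)] by blast
    then have "y \<in> poly_kernel f M" using y M by (simp add: poly_kernel_def)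
    then show False using v y by (auto simp: R_def)
  qed
  have cardR: "int (card (R X)) = int (card (poly_kernel f A)) - int (card (poly_kernel f M))"
    if X: "X \<in> embeddings A M" for X
  proof -
    have Xc: "X \<in> carrier_mat n m" "inj_mat X" using X A M by (auto simp: embeddings_def)
    have sub: "(\<lambda>y. X *\<^sub>v y) ` poly_kernel f M \<subseteq> poly_kernel f A"
      using inter[OF X, of _ f] Xc A M by (auto simp: poly_kernel_def mult_mat_zero_vec)
    have "inj_on (\<lambda>y. X *\<^sub>v y) (poly_kernel f M)"
      by (rule inj_on_subset[OF inj_mat_inj_on[OF Xc(2,1)]]) (use M in \<open>auto simp: poly_kernel_def\<close>)
    then have "card ((\<lambda>y. X *\<^sub>v y) ` poly_kernel f M) = card (poly_kernel f M)" by (rule card_image)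
    then show ?thesis unfolding R_def
      using card_Diff_subset[OF _ sub] card_mono[OF _ sub] by simp
  qed
  have "bij_betw (\<lambda>(X, v). hcat (krylov A v ?d) X) (SIGMA X:embeddings A M. R X) (embeddings A ?D)"
    unfolding bij_betw_def
  proof
    show "inj_on (\<lambda>(X, v). hcat (krylov A v ?d) X) (SIGMA X:embeddings A M. R X)"
    proof (rule inj_onI, clarify)
      fix X v X' v'
      assume X: "X \<in> embeddings A M" "X' \<in> embeddings A M" and v: "v \<in> R X" "v' \<in> R X'"
        and eq: "hcat (krylov A v ?d) X = hcat (krylov A v' ?d) X'"
      have c: "X \<in> carrier_mat n m" "X' \<in> carrier_mat n m" "v \<in> carrier_vec n" "v' \<in> carrier_vec n"
        using X v A M by (auto simp: embeddings_def R_def poly_kernel_def)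
      have *: "X = X'" "krylov A v ?d = krylov A v' ?d"
        using hcat_inject[OF krylov_carrier[OF A] c(1) krylov_carrier[OF A] c(2)] eq by auto
      have "col (krylov A u ?d) 0 = u" if "u \<in> carrier_vec n" for u
        using A that d by (simp add: col_krylov monom_0 one_pCons[symmetric])
      then show "X = X' \<and> v = v'" using * c by metis
    qed
    show "(\<lambda>(X, v). hcat (krylov A v ?d) X) ` (SIGMA X:embeddings A M. R X) = embeddings A ?D"
    proof (intro equalityI subsetI)
      fix Z assume "Z \<in> (\<lambda>(X, v). hcat (krylov A v ?d) X) ` (SIGMA X:embeddings A M. R X)"
      then obtain X v where X: "X \<in> embeddings A M" and v: "v \<in> R X" and Z: "Z = hcat (krylov A v ?d) X"
        by auto
      let ?K = "krylov A v ?d"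
      have c: "X \<in> carrier_mat n m" "v \<in> carrier_vec n" "poly_mat f A *\<^sub>v v = 0\<^sub>v n"
        and XM: "A * X = X * M" and Xi: "inj_mat X"
        using X v A M by (auto simp: embeddings_def R_def poly_kernel_def)
      have K: "?K \<in> carrier_mat n ?d" using A by simp
      have "A * Z = Z * ?D"
        unfolding Z mult_hcat[OF A K c(1)] hcat_mult_diag[OF K c(1) C M] XM
          krylov_intertwine[OF A c(2) f(2) c(3)] ..
      moreover have "inj_mat Z"
      proof (rule inj_matI)
        show "Z \<in> carrier_mat n (?d + m)" unfolding Z using K c(1) by simp
        fix w :: "'a vec" assume w: "w \<in> carrier_vec (?d + m)" and 0: "Z *\<^sub>v w = 0\<^sub>v n"
        define a b where "a = vec_first w ?d" and "b = vec_last w m"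
        have ab: "a \<in> carrier_vec ?d" "b \<in> carrier_vec m" "w = a @\<^sub>v b"
          using vec_first_last_append[OF w] by (auto simp: a_def b_def)
        have sum0: "?K *\<^sub>v a + X *\<^sub>v b = 0\<^sub>v n"
          using 0 unfolding Z ab(3) hcat_mult_vec[OF K c(1) ab(1,2)] .
        have Ka: "?K *\<^sub>v a = X *\<^sub>v (- b)"
        proof (rule eq_vecI)
          fix i assume "i < dim_vec (X *\<^sub>v (- b))"
          then have i: "i < n" using c by simp
          have neg: "(X *\<^sub>v (- b)) $ i = - (X *\<^sub>v b) $ i"
            using c(1) ab(2) i by (simp add: scalar_prod_def sum_negf)
          have "(?K *\<^sub>v a) $ i + (X *\<^sub>v b) $ i = 0"
            using arg_cong[OF sum0, of "\<lambda>u. u $ i"] i K c(1) by (simp del: index_mult_mat_vec)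
          then show "(?K *\<^sub>v a) $ i = (X *\<^sub>v (- b)) $ i"
            unfolding neg by (simp only: eq_neg_iff_add_eq_0)
        qed (use K c in auto)
        \<comment> \<open>Otherwise a, read as a nonzero polynomial of degree below that of f, is
          coprime to f and acts invertibly on v. Undoing it in \<open>Ka\<close> would place v in
          the column space of X.\<close>
        have "a = 0\<^sub>v ?d"
        proof (rule ccontr)
          assume "a \<noteq> 0\<^sub>v ?d"
          then obtain i where i: "i < ?d" "a $ i \<noteq> 0" using ab(1) by (auto simp: vec_eq_iff)
          let ?p = "vec_poly ?d a"
          have ci: "coeff ?p i \<noteq> 0" using i by (simp add: coeff_vec_poly)
          then have "?p \<noteq> 0" by auto
          moreover have "degree ?p < ?d" using d by (intro degree_lessI) (auto simp: coeff_vec_poly)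
          ultimately have "\<not> f dvd ?p" using dvd_imp_degree_le[of f ?p] by auto
          from poly_mat_invertible_on_kernel[OF f(1) this] obtain r where
            r: "\<And>n A v. A \<in> carrier_mat n n \<Longrightarrow> v \<in> carrier_vec n \<Longrightarrow> poly_mat f A *\<^sub>v v = 0\<^sub>v n
              \<Longrightarrow> poly_mat r A *\<^sub>v (poly_mat ?p A *\<^sub>v v) = v" by blast
          have "v = poly_mat r A *\<^sub>v (X *\<^sub>v (- b))"
            using r[OF A c(2,3)] Ka by (simp add: krylov_mult_vec[OF A c(2) ab(1)])
          also have "\<dots> = X *\<^sub>v (poly_mat r M *\<^sub>v (- b))"
            by (rule inter[OF X]) (use ab in auto)
          finally have "v \<in> (\<lambda>y. X *\<^sub>v y) ` carrier_vec m"
            using mult_mat_vec_carrier[OF Q[of r], of "- b"] ab(2) by auto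
          then show False using R_notin[OF X v] by simp
        qed
        moreover from this have "X *\<^sub>v b = 0\<^sub>v n"
          using sum0 c(1) mult_mat_zero_vec[OF K] by (simp add: mult_mat_vec_carrier[OF c(1) ab(2)])
        then have "b = 0\<^sub>v m" using inj_matD[OF Xi c(1) ab(2)] by simp
        ultimately show "w = 0\<^sub>v (?d + m)" using ab(3) by (auto intro!: eq_vecI)
      qed
      ultimately show "Z \<in> embeddings A ?D"
        using A M K c(1) by (simp add: embeddings_def Z)
    next
      fix Z assume "Z \<in> embeddings A ?D"
      then have Z: "Z \<in> carrier_mat n (?d + m)" and eq: "A * Z = Z * ?D" and Zi: "inj_mat Z"
        using A M D by (auto simp: embeddings_def)
      from hcat_cases[OF Z] obtain K X where K: "K \<in> carrier_mat n ?d" and X: "X \<in> carrier_mat n m"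
        and ZKX: "Z = hcat K X" .
      have eqs: "A * K = K * ?C" "A * X = X * M"
        using eq hcat_inject[OF mult_carrier_mat[OF A K] mult_carrier_mat[OF A X]
            mult_carrier_mat[OF K C] mult_carrier_mat[OF X M]]
        unfolding ZKX mult_hcat[OF A K X] hcat_mult_diag[OF K X C M] by auto
      define v where "v = K *\<^sub>v unit_vec ?d 0"
      have v: "v \<in> carrier_vec n" using K by (auto simp: v_def)
      have Kv: "K = krylov A v ?d" unfolding v_def by (rule krylov_unique[OF A K eqs(1)])
      have PC: "poly_mat f ?C \<in> carrier_mat ?d ?d" by (rule poly_mat_carrier) simp
      have "poly_mat f A *\<^sub>v v = K *\<^sub>v (poly_mat f ?C *\<^sub>v unit_vec ?d 0)"
        using poly_mat_intertwine[OF A C K eqs(1), of f] unfolding v_def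
        by (simp add: assoc_mult_mat_vec[OF P K, symmetric] assoc_mult_mat_vec[OF K PC, symmetric])
      then have vker: "v \<in> poly_kernel f A"
        using v A by (simp add: poly_mat_companion_unit_vec[OF f(2) d] mult_mat_zero_vec[OF K] poly_kernel_def)
      have Xi: "inj_mat X"
      proof (rule inj_matI[OF X])
        fix b assume b: "b \<in> carrier_vec m" "X *\<^sub>v b = 0\<^sub>v n"
        then have "Z *\<^sub>v (0\<^sub>v ?d @\<^sub>v b) = 0\<^sub>v n"
          unfolding ZKX by (subst hcat_mult_vec[OF K X]) (auto simp: mult_mat_zero_vec[OF K])
        then have *: "0\<^sub>v ?d @\<^sub>v b = 0\<^sub>v (?d + m)" using inj_matD[OF Zi Z] b(1) by simp
        show "b = 0\<^sub>v m"
        proof (rule eq_vecI)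
          fix i assume "i < dim_vec (0\<^sub>v m :: 'a vec)"
          then show "b $ i = 0\<^sub>v m $ i" using arg_cong[OF *, of "\<lambda>u. u $ (?d + i)"] b(1) by simp
        qed (use b in simp)
      qed
      have "v \<notin> (\<lambda>y. X *\<^sub>v y) ` carrier_vec m"
      proof
        assume "v \<in> (\<lambda>y. X *\<^sub>v y) ` carrier_vec m"
        then obtain y where y: "y \<in> carrier_vec m" "v = X *\<^sub>v y" by auto
        have "Z *\<^sub>v (unit_vec ?d 0 @\<^sub>v (- y)) = v + X *\<^sub>v (- y)"
          unfolding ZKX v_def by (rule hcat_mult_vec[OF K X]) (use y in auto)
        also have "\<dots> = 0\<^sub>v n" unfolding y(2) using X y(1)
          by (auto simp: scalar_prod_def sum_negf intro!: eq_vecI)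
        finally have *: "unit_vec ?d 0 @\<^sub>v (- y) = 0\<^sub>v (?d + m)" using inj_matD[OF Zi Z] y(1) by simp
        show False using arg_cong[OF *, of "\<lambda>u. u $ 0"] d by simp
      qed
      then have "v \<in> R X" using vker M by (auto simp: R_def poly_kernel_def)
      moreover have "X \<in> embeddings A M" using X A M eqs Xi by (simp add: embeddings_def)
      ultimately show "Z \<in> (\<lambda>(X, v). hcat (krylov A v ?d) X) ` (SIGMA X:embeddings A M. R X)"
        unfolding ZKX Kv by force
    qed
  qed
  then have "card (embeddings A ?D) = card (SIGMA X:embeddings A M. R X)"
    by (rule bij_betw_same_card[symmetric])
  also have "\<dots> = (\<Sum>X\<in>embeddings A M. card (R X))"
    by (rule card_SigmaI) (auto simp: R_def)
  finally show ?thesis by (simp add: cardR)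
qed

lemma poly_kernel_diag_card:
  fixes C M :: "'a::{field,finite} mat"
  assumes C: "C \<in> carrier_mat d d" and M: "M \<in> carrier_mat m m"
  shows "card (poly_kernel p (four_block_mat C (0\<^sub>m d m) (0\<^sub>m m d) M))
    = card (poly_kernel p C) * card (poly_kernel p M)"
proof -
  let ?D = "four_block_mat C (0\<^sub>m d m) (0\<^sub>m m d) M"
  have P: "poly_mat p C \<in> carrier_mat d d" "poly_mat p M \<in> carrier_mat m m" using C M by auto
  have eq: "poly_mat p ?D *\<^sub>v (a @\<^sub>v b) = (poly_mat p C *\<^sub>v a) @\<^sub>v (poly_mat p M *\<^sub>v b)"
    if "a \<in> carrier_vec d" "b \<in> carrier_vec m" for a b
  proof -
    have "poly_mat p ?D *\<^sub>v (a @\<^sub>v b)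
        = (poly_mat p C *\<^sub>v a + 0\<^sub>m d m *\<^sub>v b) @\<^sub>v (0\<^sub>m m d *\<^sub>v a + poly_mat p M *\<^sub>v b)"
      unfolding poly_mat_diag[OF C M] by (rule four_block_mat_mult_vec) (use P that in auto)
    moreover have "poly_mat p C *\<^sub>v a + 0\<^sub>m d m *\<^sub>v b = poly_mat p C *\<^sub>v a"
      using P that by (auto intro!: eq_vecI)
    moreover have "0\<^sub>m m d *\<^sub>v a + poly_mat p M *\<^sub>v b = poly_mat p M *\<^sub>v b"
      using P that by (auto intro!: eq_vecI)
    ultimately show ?thesis by simp
  qed
  have app0: "a @\<^sub>v b = 0\<^sub>v (d + m) \<longleftrightarrow> a = 0\<^sub>v d \<and> b = 0\<^sub>v m"
    if "a \<in> carrier_vec d" "b \<in> carrier_vec m" for a b :: "'a vec"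
  proof -
    have "0\<^sub>v (d + m) = 0\<^sub>v d @\<^sub>v (0\<^sub>v m :: 'a vec)" by (auto intro!: eq_vecI)
    then show ?thesis using append_vec_eq[of a d "0\<^sub>v d" b "0\<^sub>v m"] that by simp
  qed
  have "bij_betw (\<lambda>(a, b). a @\<^sub>v b) (poly_kernel p C \<times> poly_kernel p M) (poly_kernel p ?D)"
    unfolding bij_betw_def
  proof
    show "inj_on (\<lambda>(a, b). a @\<^sub>v b) (poly_kernel p C \<times> poly_kernel p M)"
      using C by (auto intro!: inj_onI simp: poly_kernel_def append_vec_eq)
    show "(\<lambda>(a, b). a @\<^sub>v b) ` (poly_kernel p C \<times> poly_kernel p M) = poly_kernel p ?D"
    proof (intro equalityI subsetI)
      fix w assume "w \<in> (\<lambda>(a, b). a @\<^sub>v b) ` (poly_kernel p C \<times> poly_kernel p M)"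
      then show "w \<in> poly_kernel p ?D"
        using C M P by (auto simp: poly_kernel_def eq app0)
    next
      fix w assume w: "w \<in> poly_kernel p ?D"
      then have wc: "w \<in> carrier_vec (d + m)" using C M by (auto simp: poly_kernel_def)
      define a b where "a = vec_first w d" and "b = vec_last w m"
      have ab: "a \<in> carrier_vec d" "b \<in> carrier_vec m" "w = a @\<^sub>v b"
        using vec_first_last_append[OF wc] by (auto simp: a_def b_def)
      then have "(poly_mat p C *\<^sub>v a) @\<^sub>v (poly_mat p M *\<^sub>v b) = 0\<^sub>v (d + m)"
        using w C M by (simp add: poly_kernel_def eq)
      then have "a \<in> poly_kernel p C" "b \<in> poly_kernel p M"
        using ab C M app0[OF mult_mat_vec_carrier[OF P(1) ab(1)] mult_mat_vec_carrier[OF P(2) ab(2)]]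
        by (auto simp: poly_kernel_def)
      then show "w \<in> (\<lambda>(a, b). a @\<^sub>v b) ` (poly_kernel p C \<times> poly_kernel p M)" using ab(3) by force
    qed
  qed
  from bij_betw_same_card[OF this] show ?thesis by (simp add: card_cartesian_product)
qed

lemma monic_irreducible_dvd_eq:
  fixes f g :: "'a::field poly"
  assumes "irreducible f" "lead_coeff f = 1" "irreducible g" "lead_coeff g = 1" "f dvd g"
  shows "f = g"
proof -
  from assms(5) obtain h where h: "g = f * h" by (elim dvdE)
  then have "h dvd 1" using assms(1,3) irreducibleD[OF assms(3) h] by (auto simp: irreducible_def)
  moreover have "h \<noteq> 0" using h assms(3) by auto
  ultimately have "degree h = 0" by (simp add: is_unit_iff_degree)
  moreover have "lead_coeff h = 1" using h assms(2,4) by (simp add: lead_coeff_mult)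
  ultimately have "h = 1" by (auto elim!: degree_eq_zeroE simp: one_pCons)
  then show ?thesis using h by simp
qed

text \<open>f(C) = 0, so the kernel on which a Bezout coefficient inverts p(C) is the whole
  space.\<close>

lemma companion_kernel_trivial:
  fixes f p :: "'a::field poly"
  assumes f: "irreducible f" "lead_coeff f = 1" and "\<not> f dvd p"
  shows "poly_kernel p (companion f) = {0\<^sub>v (degree f)}"
proof -
  have C: "companion f \<in> carrier_mat (degree f) (degree f)" by simp
  have P: "poly_mat q (companion f) \<in> carrier_mat (degree f) (degree f)" for q by (rule poly_mat_carrier) simp
  from poly_mat_invertible_on_kernel[OF f(1) assms(3)] obtain a where
    a: "\<And>n A v. A \<in> carrier_mat n n \<Longrightarrow> v \<in> carrier_vec n \<Longrightarrow> poly_mat f A *\<^sub>v v = 0\<^sub>v n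
      \<Longrightarrow> poly_mat a A *\<^sub>v (poly_mat p A *\<^sub>v v) = v" by blast
  have "v = 0\<^sub>v (degree f)" if v: "v \<in> carrier_vec (degree f)"
    and 0: "poly_mat p (companion f) *\<^sub>v v = 0\<^sub>v (degree f)" for v
  proof -
    have "poly_mat f (companion f) *\<^sub>v v = 0\<^sub>v (degree f)"
      using v by (auto simp: poly_mat_companion[OF f(2) irreducible_poly_degree_pos[OF f(1)]])
    then show ?thesis using a[OF C v] unfolding 0 mult_mat_zero_vec[OF P] by simp
  qed
  then show ?thesis by (auto simp: poly_kernel_def mult_mat_zero_vec[OF P])
qed

lemma card_poly_kernel_companion:
  fixes f g :: "'a::{field,finite} poly"
  assumes f: "irreducible f" "lead_coeff f = 1" and g: "irreducible g" "lead_coeff g = 1"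
  shows "card (poly_kernel g (companion f)) = (if f = g then CARD('a) ^ degree f else 1)"
proof (cases "f = g")
  case True
  have "poly_kernel f (companion f) = carrier_vec (degree f)"
    by (auto simp: poly_kernel_def poly_mat_companion[OF f(2) irreducible_poly_degree_pos[OF f(1)]])
  then show ?thesis using True by (simp add: finite_card_carrier_vec)
next
  case False
  then have "\<not> f dvd g" using monic_irreducible_dvd_eq[OF f g] by blast
  then show ?thesis using False companion_kernel_trivial[OF f] by simp
qed

text \<open>The determinant vanishes only if x has a kernel on K[x]/(f), which forces f to divide x.
  A nonzero constant term of f rules this out.\<close>

lemma det_companion_nonzero:
  fixes f :: "'a::field poly"
  assumes f: "irreducible f" "lead_coeff f = 1" and 0: "coeff f 0 \<noteq> 0"
  shows "det (companion f) \<noteq> 0"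
proof
  let ?C = "companion f"
  have C: "?C \<in> carrier_mat (degree f) (degree f)" by simp
  assume "det ?C = 0"
  then obtain v where v: "v \<in> carrier_vec (degree f)" "v \<noteq> 0\<^sub>v (degree f)" "?C *\<^sub>v v = 0\<^sub>v (degree f)"
    using det_0_iff_vec_prod_zero_field[OF C] by blast
  have "\<not> f dvd [:0, 1:]"
  proof
    assume "f dvd [:0, 1:]"
    then obtain h where h: "[:0, 1:] = f * h" by (elim dvdE)
    have "coeff h 0 = 0" using arg_cong[OF h, of "\<lambda>p. coeff p 0"] 0 by (simp add: coeff_mult_0)
    then obtain k where k: "h = pCons 0 k" by (cases h) auto
    have "[:1:] = f * k" using h k by simp
    then have "f dvd 1" by (simp add: one_pCons)
    then show False using f(1) by (simp add: irreducible_def)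
  qed
  moreover have "v \<in> poly_kernel [:0, 1:] ?C"
    using v poly_mat_pCons_0_vec[OF C v(1), of 1] by (simp add: poly_kernel_def one_pCons[symmetric] poly_mat_1[OF C])
  ultimately show False using companion_kernel_trivial[OF f, of "[:0, 1:]"] v(2) by auto
qed

section \<open>Direct sums of companion matrices\<close>

fun companion_sum :: "'a::comm_ring_1 poly list \<Rightarrow> 'a mat" where
  "companion_sum [] = 1\<^sub>m 0"
| "companion_sum (f # fs) =
    (let m = dim_row (companion_sum fs); d = degree f
     in four_block_mat (companion f) (0\<^sub>m d m) (0\<^sub>m m d) (companion_sum fs))"

lemma companion_sum_carrier [simp]:
  "companion_sum fs \<in> carrier_mat (sum_list (map degree fs)) (sum_list (map degree fs))"
  by (induction fs) (auto simp: Let_def)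

lemma companion_sum_Cons:
  fixes f :: "'a::comm_ring_1 poly" and fs :: "'a poly list"
  defines "m \<equiv> sum_list (map degree fs)"
  shows "companion_sum (f # fs) = four_block_mat (companion f)
    (0\<^sub>m (degree f) m) (0\<^sub>m m (degree f)) (companion_sum fs)"
  using carrier_matD(1)[OF companion_sum_carrier[of fs]] by (simp add: Let_def m_def)

declare companion_sum.simps(2) [simp del]

definition monic_irreducible :: "'a::field poly \<Rightarrow> bool" where
  "monic_irreducible f \<longleftrightarrow> irreducible f \<and> lead_coeff f = 1"

lemma det_companion_sum_nonzero:
  fixes fs :: "'a::field poly list"
  assumes "\<And>f. f \<in> set fs \<Longrightarrow> monic_irreducible f \<and> coeff f 0 \<noteq> 0"
  shows "det (companion_sum fs) \<noteq> 0"
  using assms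
proof (induction fs)
  case (Cons f fs)
  then show ?case
    unfolding companion_sum_Cons
    by (subst det_four_block_mat_lower_left_zero)
       (auto simp: monic_irreducible_def det_companion_nonzero)
qed simp

lemma card_poly_kernel_companion_sum:
  fixes fs :: "'a::{field,finite} poly list"
  assumes "\<And>f. f \<in> set fs \<Longrightarrow> monic_irreducible f" and "monic_irreducible g"
  shows "card (poly_kernel g (companion_sum fs)) = CARD('a) ^ (degree g * count_list fs g)"
  using assms
proof (induction fs)
  case Nil
  have "poly_kernel g (1\<^sub>m 0 :: 'a mat) = {0\<^sub>v 0}" by (auto simp: poly_kernel_def)
  then show ?case by simp
next
  case (Cons f fs)
  then show ?case
    unfolding companion_sum_Cons
    by (subst poly_kernel_diag_card)
       (auto simp: card_poly_kernel_companion monic_irreducible_def algebra_simps power_add)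
qed

text \<open>When i copies of f are already present, the kernel of f on the sum has Q^i elements
  whatever the other blocks are, so a further copy contributes the factor with index i. The product
  is taken in \<open>int\<close> because factors beyond a vanishing one are negative.\<close>

lemma card_embeddings_companion_sum_list:
  fixes A :: "'a::{field,finite} mat"
  assumes A: "A \<in> carrier_mat n n" and fin: "finite \<Phi>" and \<Phi>: "\<And>f. f \<in> \<Phi> \<Longrightarrow> monic_irreducible f"
    and fs: "set fs \<subseteq> \<Phi>"
  shows "int (card (embeddings A (companion_sum fs)))
    = (\<Prod>f\<in>\<Phi>. \<Prod>i<count_list fs f. int (card (poly_kernel f A)) - int ((CARD('a) ^ degree f) ^ i))"
  using fs
proof (induction fs)
  case Nil
  have "embeddings A (1\<^sub>m 0) = {0\<^sub>m n 0}"
    using A by (auto simp: embeddings_def inj_mat_def)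
  then show ?case by simp
next
  case (Cons f fs)
  let ?t = "\<lambda>g i. int (card (poly_kernel g A)) - int ((CARD('a) ^ degree g) ^ i)"
  have f: "monic_irreducible f" "f \<in> \<Phi>" using Cons.prems \<Phi> by auto
  have "int (card (embeddings A (companion_sum (f # fs))))
      = int (card (embeddings A (companion_sum fs))) * ?t f (count_list fs f)"
    unfolding companion_sum_Cons
    using f Cons.prems \<Phi> by (subst card_embeddings_companion_sum[OF A])
      (auto simp: monic_irreducible_def[of f] card_poly_kernel_companion_sum power_mult subset_iff)
  also have "\<dots> = (\<Prod>g\<in>\<Phi>. \<Prod>i<count_list fs g. ?t g i) * ?t f (count_list fs f)"
    using Cons by simp
  \<comment> \<open>Prepending f changes the count of f only, so the product over the remaining
    irreducibles can already be written with the longer list.\<close>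
  also have "(\<Prod>g\<in>\<Phi>. \<Prod>i<count_list fs g. ?t g i)
      = (\<Prod>i<count_list fs f. ?t f i) * (\<Prod>g\<in>\<Phi> - {f}. \<Prod>i<count_list (f # fs) g. ?t g i)"
    unfolding prod.remove[OF fin f(2)] by (intro arg_cong2[where f = "(*)"] prod.cong) auto
  also have "\<dots> * ?t f (count_list fs f) = (\<Prod>g\<in>\<Phi>. \<Prod>i<count_list (f # fs) g. ?t g i)"
    unfolding prod.remove[OF fin f(2)] by (simp add: mult_ac)
  finally show ?case .
qed

subsection \<open>The mean number of embeddings\<close>

text \<open>The standard inclusion of K^m into K^n: multiplying by it on the right selects the first
  m columns.\<close>

definition incl_mat :: "nat \<Rightarrow> nat \<Rightarrow> 'a::comm_ring_1 mat" where
  "incl_mat n m = mat n m (\<lambda>(i,j). if i = j then 1 else 0)"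

lemma incl_mat_carrier [simp]: "incl_mat n m \<in> carrier_mat n m"
  by (simp add: incl_mat_def)

lemma incl_mat_dim [simp]: "dim_row (incl_mat n m) = n" "dim_col (incl_mat n m) = m"
  by (simp_all add: incl_mat_def)

lemma mult_incl_mat:
  fixes T :: "'a::comm_ring_1 mat"
  assumes T: "T \<in> carrier_mat p n" and "m \<le> n"
  shows "T * incl_mat n m = mat p m (\<lambda>(i,j). T $$ (i,j))"
proof (rule eq_matI)
  fix i j assume "i < dim_row (mat p m (\<lambda>(i,j). T $$ (i,j)))" "j < dim_col (mat p m (\<lambda>(i,j). T $$ (i,j)))"
  then have ij: "i < p" "j < m" "j < n" using assms by auto
  have "col (incl_mat n m) j = (unit_vec n j :: 'a vec)"
    using ij by (auto simp: incl_mat_def unit_vec_def intro!: eq_vecI)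
  then show "(T * incl_mat n m) $$ (i,j) = mat p m (\<lambda>(i,j). T $$ (i,j)) $$ (i,j)"
    using ij T by simp
qed (use T in auto)

lemma incl_mat_self: "incl_mat n n = 1\<^sub>m n"
  by (auto simp: incl_mat_def intro!: eq_matI)

text \<open>In standard position, embedding M means leaving the span of the first m basis vectors
  invariant and acting as M there, which is block triangular form.\<close>

lemma mult_incl_mat_eq_iff:
  fixes S :: "'a::comm_ring_1 mat"
  assumes S: "S \<in> carrier_mat (m + k) (m + k)" and M: "M \<in> carrier_mat m m"
  shows "S * incl_mat (m + k) m = incl_mat (m + k) m * M
    \<longleftrightarrow> (\<exists>Y\<in>carrier_mat m k. \<exists>B\<in>carrier_mat k k. S = four_block_mat M Y (0\<^sub>m k m) B)"
proof -
  have J: "incl_mat (m + k) m = four_block_mat (1\<^sub>m m) (0\<^sub>m m 0) (0\<^sub>m k m) (0\<^sub>m k 0 :: 'a mat)"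
    by (auto simp: incl_mat_def intro!: eq_matI)
  have JM: "incl_mat (m + k) m * M = four_block_mat M (0\<^sub>m m 0) (0\<^sub>m k m) (0\<^sub>m k 0)"
  proof -
    have "M = four_block_mat M (0\<^sub>m m 0) (0\<^sub>m 0 m) (0\<^sub>m 0 0)" using M by (auto intro!: eq_matI)
    then have "incl_mat (m + k) m * M = four_block_mat (1\<^sub>m m) (0\<^sub>m m 0) (0\<^sub>m k m) (0\<^sub>m k 0)
      * four_block_mat M (0\<^sub>m m 0) (0\<^sub>m 0 m) (0\<^sub>m 0 0)" unfolding J by simp
    also have "\<dots> = four_block_mat M (0\<^sub>m m 0) (0\<^sub>m k m) (0\<^sub>m k 0)"
      by (subst mult_four_block_mat[of _ m m _ 0 _ k _ _ m _ 0]) (use M in \<open>auto intro!: cong_four_block_mat\<close>)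
    finally show ?thesis .
  qed
  show ?thesis
  proof
    assume eq: "S * incl_mat (m + k) m = incl_mat (m + k) m * M"
    have *: "S $$ (i,j) = (if i < m then M $$ (i,j) else 0)" if "i < m + k" "j < m" for i j
      using arg_cong[OF eq, of "\<lambda>Z. Z $$ (i,j)"] that M unfolding JM mult_incl_mat[OF S le_add1] by simp
    have "S = four_block_mat M (mat m k (\<lambda>(i,j). S $$ (i, m + j))) (0\<^sub>m k m)
        (mat k k (\<lambda>(i,j). S $$ (m + i, m + j)))"
      using S M * by (auto intro!: eq_matI)
    then show "\<exists>Y\<in>carrier_mat m k. \<exists>B\<in>carrier_mat k k. S = four_block_mat M Y (0\<^sub>m k m) B"
      by (intro bexI[of _ "mat m k (\<lambda>(i,j). S $$ (i, m + j))"] bexI[of _ "mat k k (\<lambda>(i,j). S $$ (m + i, m + j))"]) auto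
  next
    assume "\<exists>Y\<in>carrier_mat m k. \<exists>B\<in>carrier_mat k k. S = four_block_mat M Y (0\<^sub>m k m) B"
    then obtain Y B where YB: "Y \<in> carrier_mat m k" "B \<in> carrier_mat k k" "S = four_block_mat M Y (0\<^sub>m k m) B"
      by auto
    show "S * incl_mat (m + k) m = incl_mat (m + k) m * M"
      unfolding JM mult_incl_mat[OF S le_add1] using YB M by (auto intro!: eq_matI)
  qed
qed

text \<open>The predicate \<open>P\<close> is left free because two counts are needed: completions
  of an embedding (M is the identity, determinant nonzero) and conjugates (determinant
  prescribed).\<close>

lemma card_block_triangular:
  fixes M :: "'a::{field,finite} mat"
  assumes M: "M \<in> carrier_mat m m"
  shows "card {S \<in> carrier_mat (m + k) (m + k). S * incl_mat (m + k) m = incl_mat (m + k) m * M \<and> P (det S)}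
    = card (carrier_mat m k :: 'a mat set) * card {B \<in> carrier_mat k k. P (det M * det B)}"
proof -
  have "bij_betw (\<lambda>(Y, B). four_block_mat M Y (0\<^sub>m k m) B)
     (carrier_mat m k \<times> {B \<in> carrier_mat k k. P (det M * det B)})
     {S \<in> carrier_mat (m + k) (m + k). S * incl_mat (m + k) m = incl_mat (m + k) m * M \<and> P (det S)}"
    unfolding bij_betw_def
  proof
    show "inj_on (\<lambda>(Y, B). four_block_mat M Y (0\<^sub>m k m) B)
      (carrier_mat m k \<times> {B \<in> carrier_mat k k. P (det M * det B)})"
    proof (rule inj_onI, clarify)
      fix Y B Y' B'
      assume c: "(Y :: 'a mat) \<in> carrier_mat m k" "Y' \<in> carrier_mat m k" "B \<in> carrier_mat k k" "B' \<in> carrier_mat k k"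
        and eq: "four_block_mat M Y (0\<^sub>m k m) B = four_block_mat M Y' (0\<^sub>m k m) B'"
      have "Y $$ (i,j) = Y' $$ (i,j)" if "i < m" "j < k" for i j
        using arg_cong[OF eq, of "\<lambda>Z. Z $$ (i, m + j)"] that c M by auto
      moreover have "B $$ (i,j) = B' $$ (i,j)" if "i < k" "j < k" for i j
        using arg_cong[OF eq, of "\<lambda>Z. Z $$ (m + i, m + j)"] that c M by auto
      ultimately show "Y = Y' \<and> B = B'" using c by (auto intro!: eq_matI)
    qed
    show "(\<lambda>(Y, B). four_block_mat M Y (0\<^sub>m k m) B) ` (carrier_mat m k \<times> {B \<in> carrier_mat k k. P (det M * det B)})
      = {S \<in> carrier_mat (m + k) (m + k). S * incl_mat (m + k) m = incl_mat (m + k) m * M \<and> P (det S)}"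
      (is "?l = ?r")
    proof (intro equalityI subsetI)
      fix S assume "S \<in> ?l"
      then obtain Y B where YB: "Y \<in> carrier_mat m k" "B \<in> carrier_mat k k" "P (det M * det B)"
        and S: "S = four_block_mat M Y (0\<^sub>m k m) B" by auto
      have "S \<in> carrier_mat (m + k) (m + k)" unfolding S using YB M by simp
      moreover have "det S = det M * det B"
        unfolding S by (rule det_four_block_mat_lower_left_zero[OF M YB(1) refl YB(2)])
      ultimately show "S \<in> ?r" using mult_incl_mat_eq_iff[OF _ M, of S k] YB S by auto
    next
      fix S assume S: "S \<in> ?r"
      then obtain Y B where YB: "Y \<in> carrier_mat m k" "B \<in> carrier_mat k k"
        and Seq: "S = four_block_mat M Y (0\<^sub>m k m) B"
        using mult_incl_mat_eq_iff[OF _ M, of S k] by auto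
      have "det S = det M * det B"
        unfolding Seq by (rule det_four_block_mat_lower_left_zero[OF M YB(1) refl YB(2)])
      then show "S \<in> ?l" using S YB Seq by auto
    qed
  qed
  from bij_betw_same_card[OF this] show ?thesis by (simp add: card_cartesian_product)
qed

section \<open>Completing injective matrices to invertible ones\<close>

lemma det_nonzero_iff_inj_mat:
  fixes T :: "'a::field mat"
  assumes "T \<in> carrier_mat n n"
  shows "det T \<noteq> 0 \<longleftrightarrow> inj_mat T"
  using det_0_iff_vec_prod_zero_field[OF assms] assms by (auto simp: inj_mat_def)

lemma obtain_inverse_mat:
  fixes T :: "'a::field mat"
  assumes T: "T \<in> carrier_mat n n" and "det T \<noteq> 0"
  obtains T' where "T' \<in> carrier_mat n n" "T * T' = 1\<^sub>m n" "T' * T = 1\<^sub>m n" "det T' * det T = 1"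
proof -
  from det_non_zero_imp_unit[OF assms, of "()"] obtain T' where
    T': "T' \<in> carrier_mat n n" "T * T' = 1\<^sub>m n" "T' * T = 1\<^sub>m n"
    by (auto simp: Units_def ring_mat_def)
  moreover have "det T' * det T = 1" using det_mult[OF T'(1) T] T'(3) by simp
  ultimately show ?thesis using that by blast
qed

text \<open>The column space has q^m elements, fewer than q^n, so some vector outside it can serve
  as the next column.\<close>

lemma inj_mat_extend_column:
  fixes X :: "'a::{field,finite} mat"
  assumes X: "X \<in> carrier_mat n m" and inj: "inj_mat X" and "m < n"
  obtains Z where "Z \<in> carrier_mat n (Suc m)" "inj_mat Z" "Z * incl_mat (Suc m) m = X"
proof -
  have q: "1 < CARD('a)" using card_mono[of "UNIV :: 'a set" "{0,1}"] by simp
  have "card ((\<lambda>v. X *\<^sub>v v) ` carrier_vec m) = CARD('a) ^ m"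
    by (simp add: card_image[OF inj_mat_inj_on[OF inj X]] finite_card_carrier_vec)
  also have "\<dots> < card (carrier_vec n :: 'a vec set)" using q \<open>m < n\<close> by (simp add: finite_card_carrier_vec)
  finally have "\<not> carrier_vec n \<subseteq> (\<lambda>v. X *\<^sub>v v) ` carrier_vec m"
    using card_mono[of "(\<lambda>v. X *\<^sub>v v) ` carrier_vec m" "carrier_vec n"] by (auto simp: finite_card_carrier_vec)
  then obtain v where v: "v \<in> carrier_vec n" "v \<notin> (\<lambda>v. X *\<^sub>v v) ` carrier_vec m" by blast
  define V where "V = mat n 1 (\<lambda>(i,j). v $ i)"
  have V: "V \<in> carrier_mat n 1" by (simp add: V_def)
  have Z: "hcat X V \<in> carrier_mat n (Suc m)" using hcat_carrier[OF X V] by simp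
  have "inj_mat (hcat X V)"
  proof (rule inj_matI[OF Z])
    fix w :: "'a vec" assume w: "w \<in> carrier_vec (Suc m)" and 0: "hcat X V *\<^sub>v w = 0\<^sub>v n"
    define a b where "a = vec_first w m" and "b = vec_last w 1"
    have ab: "a \<in> carrier_vec m" "b \<in> carrier_vec 1" "w = a @\<^sub>v b"
      using vec_first_last_append[of w m 1] w by (auto simp: a_def b_def)
    have Vb: "V *\<^sub>v b = (b $ 0) \<cdot>\<^sub>v v"
      using v(1) ab(2) by (auto simp: V_def scalar_prod_def intro!: eq_vecI)
    have sum0: "X *\<^sub>v a + (b $ 0) \<cdot>\<^sub>v v = 0\<^sub>v n"
      using 0 unfolding ab(3) hcat_mult_vec[OF X V ab(1,2)] Vb .
    have b0: "b $ 0 = 0"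
    proof (rule ccontr)
      assume b0: "b $ 0 \<noteq> 0"
      have "v = X *\<^sub>v ((- inverse (b $ 0)) \<cdot>\<^sub>v a)"
      proof (rule eq_vecI)
        fix i assume "i < dim_vec (X *\<^sub>v ((- inverse (b $ 0)) \<cdot>\<^sub>v a))"
        then have i: "i < n" using X by simp
        have "(X *\<^sub>v a) $ i + b $ 0 * v $ i = 0"
          using arg_cong[OF sum0, of "\<lambda>u. u $ i"] i X v(1) by (simp del: index_mult_mat_vec)
        then have h1: "(X *\<^sub>v a) $ i = - (b $ 0 * v $ i)" by (simp only: eq_neg_iff_add_eq_0)
        have h2: "(X *\<^sub>v ((- inverse (b $ 0)) \<cdot>\<^sub>v a)) $ i = - inverse (b $ 0) * (X *\<^sub>v a) $ i"
          using X ab(1) i by simp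
        show "v $ i = (X *\<^sub>v ((- inverse (b $ 0)) \<cdot>\<^sub>v a)) $ i"
          unfolding h2 h1 using b0 by simp
      qed (use v X in auto)
      then show False using v(2) ab(1) by auto
    qed
    then have "(b $ 0) \<cdot>\<^sub>v v = 0\<^sub>v n" using v(1) by (auto intro!: eq_vecI)
    then have "X *\<^sub>v a = 0\<^sub>v n"
      using sum0 mult_mat_vec_carrier[OF X ab(1)] by simp
    then have "a = 0\<^sub>v m" using inj_matD[OF inj X ab(1)] by simp
    then show "w = 0\<^sub>v (Suc m)" unfolding ab(3) using b0 ab(2) by (auto intro!: eq_vecI)
  qed
  moreover have "hcat X V * incl_mat (Suc m) m = X"
    unfolding mult_incl_mat[OF Z le_SucI[OF le_refl]] using X by (auto simp: hcat_def intro!: eq_matI)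
  ultimately show ?thesis using that Z by blast
qed

lemma inj_mat_extend:
  fixes X :: "'a::{field,finite} mat"
  assumes "X \<in> carrier_mat n m" "inj_mat X"
  shows "\<exists>T\<in>carrier_mat n n. det T \<noteq> 0 \<and> T * incl_mat n m = X"
  using assms
proof (induction "n - m" arbitrary: m X)
  case 0
  then have "m = n" using inj_mat_dim_le[OF 0(3,2)] by simp
  then show ?case using 0 by (auto simp: det_nonzero_iff_inj_mat incl_mat_self)
next
  case (Suc k)
  then have mn: "m < n" by simp
  from inj_mat_extend_column[OF Suc(3,4) mn] obtain Z where
    Z: "Z \<in> carrier_mat n (Suc m)" "inj_mat Z" "Z * incl_mat (Suc m) m = X" .
  have "k = n - Suc m" using Suc(2) by simp
  from Suc(1)[OF this Z(1,2)] obtain T where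
    T: "T \<in> carrier_mat n n" "det T \<noteq> 0" "T * incl_mat n (Suc m) = Z" by auto
  have "T * incl_mat n m = Z * incl_mat (Suc m) m"
    unfolding T(3)[symmetric] using mn T(1)
    by (subst (1 2 3) mult_incl_mat) (auto intro!: eq_matI)
  then show ?case using T Z(3) by auto
qed

text \<open>By \<open>rcosets_SL\<close>, for positive n and nonzero d these are exactly the cosets
  of \<open>SL n\<close>.\<close>

definition det_set :: "nat \<Rightarrow> 'a::field \<Rightarrow> 'a mat set" where
  "det_set n d = {A \<in> carrier_mat n n. det A = d}"

definition inv_set :: "nat \<Rightarrow> 'a::field mat set" where
  "inv_set n = {A \<in> carrier_mat n n. det A \<noteq> 0}"

lemma finite_det_set [simp]: "finite (det_set n d :: 'a::{field,finite} mat set)"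
  by (simp add: det_set_def)

lemma finite_inv_set [simp]: "finite (inv_set n :: 'a::{field,finite} mat set)"
  by (simp add: inv_set_def)

lemma inj_mat_mult_incl_mat:
  assumes T: "T \<in> inv_set n" and "m \<le> n"
  shows "inj_mat (T * incl_mat n m)"
proof (rule inj_matI)
  have Tc: "T \<in> carrier_mat n n" "inj_mat T" using T by (auto simp: inv_set_def det_nonzero_iff_inj_mat)
  show "T * incl_mat n m \<in> carrier_mat n m" using Tc by simp
  fix v :: "'a vec" assume v: "v \<in> carrier_vec m" and 0: "T * incl_mat n m *\<^sub>v v = 0\<^sub>v n"
  have "T *\<^sub>v (incl_mat n m *\<^sub>v v) = 0\<^sub>v n"
    using 0 assoc_mult_mat_vec[OF Tc(1) incl_mat_carrier v] by simp
  then have *: "incl_mat n m *\<^sub>v v = 0\<^sub>v n"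
    using inj_matD[OF Tc(2,1)] mult_mat_vec_carrier[OF incl_mat_carrier v] by blast
  show "v = 0\<^sub>v m"
  proof (rule eq_vecI)
    fix i assume "i < dim_vec (0\<^sub>v m :: 'a vec)"
    then have i: "i < m" by simp
    have "row (incl_mat n m) i = (unit_vec m i :: 'a vec)"
      using i \<open>m \<le> n\<close> by (auto simp: incl_mat_def unit_vec_def intro!: eq_vecI)
    then have "(incl_mat n m *\<^sub>v v) $ i = v $ i"
      using i \<open>m \<le> n\<close> v by (simp add: incl_mat_def)
    then show "v $ i = 0\<^sub>v m $ i" unfolding * using i \<open>m \<le> n\<close> by simp
  qed (use v in simp)
qed

text \<open>Any two completions of X differ by a right factor that fixes the first m basis vectors.
  Hence they correspond to the invertible block triangular matrices with identity corner, whatever X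
  is.\<close>

lemma card_extensions:
  fixes X :: "'a::{field,finite} mat"
  assumes X: "X \<in> carrier_mat (m + k) m" "inj_mat X"
  shows "card {T \<in> inv_set (m + k). T * incl_mat (m + k) m = X}
    = card (carrier_mat m k :: 'a mat set) * card (inv_set k :: 'a mat set)"
proof -
  let ?n = "m + k" let ?J = "incl_mat (m + k) m :: 'a mat"
  from inj_mat_extend[OF X] obtain T where T: "T \<in> carrier_mat ?n ?n" "det T \<noteq> 0" "T * ?J = X" by auto
  from obtain_inverse_mat[OF T(1,2)] obtain T' where
    T': "T' \<in> carrier_mat ?n ?n" "T * T' = 1\<^sub>m ?n" "T' * T = 1\<^sub>m ?n" "det T' * det T = 1" .
  have "bij_betw (\<lambda>S. T * S)
      {S \<in> carrier_mat ?n ?n. S * ?J = ?J * 1\<^sub>m m \<and> det S \<noteq> 0} {T \<in> inv_set ?n. T * ?J = X}"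
  proof (rule bij_betwI[where g = "\<lambda>S. T' * S"])
    show "(\<lambda>S. T * S) \<in> {S \<in> carrier_mat ?n ?n. S * ?J = ?J * 1\<^sub>m m \<and> det S \<noteq> 0} \<rightarrow> {T \<in> inv_set ?n. T * ?J = X}"
      using T by (auto simp: inv_set_def det_mult[OF T(1)] assoc_mult_mat[OF T(1) _ incl_mat_carrier])
    show "(\<lambda>S. T' * S) \<in> {T \<in> inv_set ?n. T * ?J = X} \<rightarrow> {S \<in> carrier_mat ?n ?n. S * ?J = ?J * 1\<^sub>m m \<and> det S \<noteq> 0}"
      using T T' by (auto simp: inv_set_def det_mult[OF T'(1)] assoc_mult_mat[OF T'(1) _ incl_mat_carrier]
          assoc_mult_mat[OF T'(1) T(1) incl_mat_carrier, symmetric] T(3)[symmetric])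
    show "T' * (T * S) = S" if "S \<in> {S \<in> carrier_mat ?n ?n. S * ?J = ?J * 1\<^sub>m m \<and> det S \<noteq> 0}" for S
      using that T' by (simp add: assoc_mult_mat[OF T'(1) T(1), of _ ?n, symmetric] left_mult_one_mat[of _ ?n ?n])
    show "T * (T' * S) = S" if "S \<in> {T \<in> inv_set ?n. T * ?J = X}" for S
      using that T' T by (simp add: assoc_mult_mat[OF T(1) T'(1), of _ ?n, symmetric] inv_set_def left_mult_one_mat[of _ ?n ?n])
  qed
  then have "card {T \<in> inv_set ?n. T * ?J = X}
      = card {S \<in> carrier_mat ?n ?n. S * ?J = ?J * 1\<^sub>m m \<and> det S \<noteq> 0}"
    by (rule bij_betw_same_card[symmetric])
  also have "\<dots> = card (carrier_mat m k :: 'a mat set) * card {B \<in> carrier_mat k k. det (1\<^sub>m m :: 'a mat) * det B \<noteq> 0}"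
    by (rule card_block_triangular) simp
  finally show ?thesis by (simp add: inv_set_def)
qed

text \<open>Conjugation by T moves the embedding into standard position and keeps the determinant,
  so the count is that of block triangular matrices and does not depend on T.\<close>

lemma card_conjugates:
  fixes M :: "'a::{field,finite} mat"
  assumes T: "T \<in> inv_set (m + k)" and M: "M \<in> carrier_mat m m"
  shows "card {A \<in> det_set (m + k) d. A * (T * incl_mat (m + k) m) = T * incl_mat (m + k) m * M}
    = card (carrier_mat m k :: 'a mat set) * card {B \<in> carrier_mat k k. det M * det B = d}"
proof -
  let ?n = "m + k" let ?J = "incl_mat (m + k) m :: 'a mat"
  have Tc: "T \<in> carrier_mat ?n ?n" "det T \<noteq> 0" using T by (auto simp: inv_set_def)
  from obtain_inverse_mat[OF Tc] obtain T' where
    T': "T' \<in> carrier_mat ?n ?n" "T * T' = 1\<^sub>m ?n" "T' * T = 1\<^sub>m ?n" "det T' * det T = 1" .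
  have J: "?J \<in> carrier_mat ?n m" by simp
  have c1: "T' * (T * Z) = Z" if "Z \<in> carrier_mat ?n r" for Z r
    using that T' by (simp add: assoc_mult_mat[OF T'(1) Tc(1) that, symmetric])
  have c2: "T * (T' * Z) = Z" if "Z \<in> carrier_mat ?n r" for Z r
    using that T' by (simp add: assoc_mult_mat[OF Tc(1) T'(1) that, symmetric])
  have as: "(X * Y) * Z = X * (Y * Z)" if "X \<in> carrier_mat ?n ?n" "Y \<in> carrier_mat ?n ?n" "Z \<in> carrier_mat ?n r"
    for X Y Z :: "'a mat" and r by (rule assoc_mult_mat[OF that])
  have "bij_betw (\<lambda>S. T * (S * T'))
      {S \<in> carrier_mat ?n ?n. S * ?J = ?J * M \<and> det S = d}
      {A \<in> det_set ?n d. A * (T * ?J) = T * ?J * M}"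
  proof (rule bij_betwI[where g = "\<lambda>A. T' * (A * T)"])
    show "(\<lambda>S. T * (S * T')) \<in> {S \<in> carrier_mat ?n ?n. S * ?J = ?J * M \<and> det S = d}
        \<rightarrow> {A \<in> det_set ?n d. A * (T * ?J) = T * ?J * M}"
    proof clarify
      fix S assume S: "S \<in> carrier_mat ?n ?n" "S * ?J = ?J * M" "d = det S"
      have "det (T * (S * T')) = (det T' * det T) * det S"
        using S T' Tc by (simp add: det_mult[of _ ?n] mult_ac)
      moreover have "T * (S * T') * (T * ?J) = T * ?J * M"
      proof -
        have "T * (S * T') * (T * ?J) = T * (S * (T' * (T * ?J)))"
          using S(1) T'(1) Tc(1) by (simp add: as[of _ _ _ m])
        also have "\<dots> = T * (?J * M)" by (simp add: c1[OF J] S(2))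
        finally show ?thesis by (simp add: assoc_mult_mat[OF Tc(1) J M])
      qed
      ultimately show "T * (S * T') \<in> det_set ?n (det S) \<and> T * (S * T') * (T * ?J) = T * ?J * M"
        using S T' Tc by (simp add: det_set_def)
    qed
    show "(\<lambda>A. T' * (A * T)) \<in> {A \<in> det_set ?n d. A * (T * ?J) = T * ?J * M}
        \<rightarrow> {S \<in> carrier_mat ?n ?n. S * ?J = ?J * M \<and> det S = d}"
    proof clarify
      fix A assume A0: "A \<in> det_set ?n d" and AJ: "A * (T * ?J) = T * ?J * M"
      then have A: "A \<in> carrier_mat ?n ?n" "det A = d" by (auto simp: det_set_def)
      have "det (T' * (A * T)) = (det T' * det T) * det A"
        using A T' Tc by (simp add: det_mult[of _ ?n] mult_ac)
      moreover have "T' * (A * T) * ?J = ?J * M"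
      proof -
        have "T' * (A * T) * ?J = T' * (A * (T * ?J))"
          using A(1) T'(1) Tc(1) by (simp add: as[of _ _ _ m])
        also have "\<dots> = T' * (T * (?J * M))" by (simp add: AJ assoc_mult_mat[OF Tc(1) J M])
        finally show ?thesis by (simp add: c1[OF mult_carrier_mat[OF J M]])
      qed
      ultimately show "T' * (A * T) \<in> carrier_mat ?n ?n \<and> T' * (A * T) * ?J = ?J * M \<and> det (T' * (A * T)) = d"
        using A T' Tc by simp
    qed
    show "T' * (T * (S * T') * T) = S" if "S \<in> {S \<in> carrier_mat ?n ?n. S * ?J = ?J * M \<and> det S = d}" for S
    proof -
      have S: "S \<in> carrier_mat ?n ?n" using that by simp
      have "T * (S * T') * T = T * S"
        unfolding as[OF Tc(1) mult_carrier_mat[OF S T'(1)] Tc(1)] as[OF S T'(1) Tc(1)] T'(3) using S by simp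
      then show ?thesis by (simp add: c1[OF S])
    qed
    show "T * (T' * (A * T) * T') = A" if "A \<in> {A \<in> det_set ?n d. A * (T * ?J) = T * ?J * M}" for A
    proof -
      have A: "A \<in> carrier_mat ?n ?n" using that by (simp add: det_set_def)
      have "T' * (A * T) * T' = T' * A"
        unfolding as[OF T'(1) mult_carrier_mat[OF A Tc(1)] T'(1)] as[OF A Tc(1) T'(1)] T'(2) using A by simp
      then show ?thesis by (simp add: c2[OF A])
    qed
  qed
  then have "card {A \<in> det_set ?n d. A * (T * ?J) = T * ?J * M}
     = card {S \<in> carrier_mat ?n ?n. S * ?J = ?J * M \<and> det S = d}"
    by (rule bij_betw_same_card[symmetric])
  also have "\<dots> = card (carrier_mat m k :: 'a mat set) * card {B \<in> carrier_mat k k. det M * det B = d}"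
    by (rule card_block_triangular[OF M])
  finally show ?thesis .
qed

text \<open>Double counting of the pairs of a matrix \<open>A\<close> of determinant \<open>d\<close> and an invertible \<open>T\<close> whose first
  \<open>m\<close> columns form an embedding of \<open>M\<close> into \<open>A\<close>; this avoids computing the order of \<open>GL\<close>.\<close>

lemma sum_card_embeddings:
  fixes M :: "'a::{field,finite} mat"
  assumes M: "M \<in> carrier_mat m m"
  shows "(\<Sum>A\<in>det_set (m + k) d. card (embeddings A M)) * card (inv_set k :: 'a mat set)
    = card (inv_set (m + k) :: 'a mat set) * card {B \<in> carrier_mat k k. det M * det B = d}"
proof -
  let ?n = "m + k" let ?J = "incl_mat (m + k) m :: 'a mat"
  let ?K = "card (carrier_mat m k :: 'a mat set)"
  have J: "?J \<in> carrier_mat ?n m" by simp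
  have "(0\<^sub>m m k :: 'a mat) \<in> carrier_mat m k" by simp
  \<comment> \<open>\<open>?K\<close> occurs as a factor on both sides of the double count and is
    cancelled at the end; for this it must be positive.\<close>
  then have K: "?K > 0" using card_gt_0_iff[of "carrier_mat m k :: 'a mat set"] by auto
  \<comment> \<open>For fixed A, such a T is an embedding, given by its first m columns, together
    with a completion of that embedding to an invertible matrix.\<close>
  have fiber: "card {T \<in> inv_set ?n. A * (T * ?J) = T * ?J * M} = card (embeddings A M) * (?K * card (inv_set k :: 'a mat set))"
    if A: "A \<in> det_set ?n d" for A
  proof -
    have A: "A \<in> carrier_mat ?n ?n" using A by (simp add: det_set_def)
    have "card {T \<in> inv_set ?n. A * (T * ?J) = T * ?J * M}
        = card (\<Union>X\<in>embeddings A M. {T \<in> inv_set ?n. T * ?J = X})"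
      by (rule arg_cong[of _ _ card])
         (use A M inj_mat_mult_incl_mat[where 'a = 'a, of _ ?n m] in \<open>auto simp: embeddings_def inv_set_def\<close>)
    also have "\<dots> = (\<Sum>X\<in>embeddings A M. card {T \<in> inv_set ?n. T * ?J = X})"
      by (rule card_UN_disjoint) auto
    also have "\<dots> = (\<Sum>X\<in>embeddings A M. ?K * card (inv_set k :: 'a mat set))"
      by (rule sum.cong[OF refl], rule card_extensions) (use A M in \<open>auto simp: embeddings_def\<close>)
    finally show ?thesis by simp
  qed
  have "(\<Sum>A\<in>det_set ?n d. card {T \<in> inv_set ?n. A * (T * ?J) = T * ?J * M})
      = card (SIGMA A:det_set ?n d. {T \<in> inv_set ?n. A * (T * ?J) = T * ?J * M})"
    by (rule card_SigmaI[symmetric]) auto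
  also have "\<dots> = card (SIGMA T:inv_set ?n. {A \<in> det_set ?n d. A * (T * ?J) = T * ?J * M})"
    by (rule bij_betw_same_card[of prod.swap]) (auto simp: bij_betw_def inj_on_def image_iff)
  also have "\<dots> = (\<Sum>T\<in>inv_set ?n. card {A \<in> det_set ?n d. A * (T * ?J) = T * ?J * M})"
    by (rule card_SigmaI) auto
  also have "\<dots> = (\<Sum>T\<in>(inv_set ?n :: 'a mat set). ?K * card {B \<in> carrier_mat k k. det M * det B = d})"
    by (rule sum.cong[OF refl], rule card_conjugates[OF _ M])
  finally have "(\<Sum>A\<in>det_set ?n d. card (embeddings A M)) * (?K * card (inv_set k :: 'a mat set))
      = card (inv_set ?n :: 'a mat set) * (?K * card {B \<in> carrier_mat k k. det M * det B = d})"
    by (simp add: fiber sum_distrib_right)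
  then have "?K * ((\<Sum>A\<in>det_set ?n d. card (embeddings A M)) * card (inv_set k :: 'a mat set))
      = ?K * (card (inv_set ?n :: 'a mat set) * card {B \<in> carrier_mat k k. det M * det B = d})"
    by (simp only: mult_ac)
  then show ?thesis using K unfolding mult_cancel1 by linarith
qed

section \<open>Means over a determinant class\<close>

lemma card_inv_set:
  fixes d :: "'a::{field,finite}"
  assumes "0 < n" "d \<noteq> 0"
  shows "card (inv_set n :: 'a mat set) = (CARD('a) - 1) * card (det_set n d)"
proof -
  interpret group "GL n :: 'a mat monoid" by (rule group_GL)
  \<comment> \<open>Every nonzero determinant class is a coset of \<open>SL n\<close>, and cosets
    are equally large. In size 0 only the determinant 1 occurs, hence \<open>0 < n\<close>.\<close>
  have eq: "card (det_set n e) = card (SL n :: 'a mat set)" if "e \<noteq> 0" for e :: 'a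
  proof -
    have "det_set n e \<in> rcosets\<^bsub>GL n\<^esub> SL n"
      using that unfolding rcosets_SL[OF assms(1)] det_set_def by blast
    then show ?thesis using card_rcosets_equal[of "det_set n e" "SL n"] subgroup.subset[OF subgroup_SL] by metis
  qed
  have "inv_set n = (\<Union>e\<in>UNIV - {0::'a}. det_set n e)" by (auto simp: inv_set_def det_set_def)
  then have "card (inv_set n :: 'a mat set) = (\<Sum>e\<in>UNIV - {0::'a}. card (det_set n e))"
    by (simp only:) (rule card_UN_disjoint, auto simp: det_set_def)
  also have "\<dots> = (CARD('a) - 1) * card (SL n :: 'a mat set)" by (simp add: eq)
  finally show ?thesis using eq[OF assms(2)] by simp
qed

lemma inv_set_pos: "0 < card (inv_set n :: 'a::{field,finite} mat set)"
proof -
  have "(1\<^sub>m n :: 'a mat) \<in> inv_set n" by (simp add: inv_set_def)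
  then show ?thesis using card_gt_0_iff[of "inv_set n :: 'a mat set"] by auto
qed

lemma det_set_pos:
  fixes d :: "'a::{field,finite}"
  assumes "0 < n" "d \<noteq> 0"
  shows "0 < card (det_set n d)"
  using card_inv_set[OF assms] inv_set_pos[of n, where 'a = 'a] by (simp add: card_gt_0_iff)

text \<open>The complementary block must have determinant d / det M. Since it has positive size,
  that class is the fraction 1 / (q - 1) of the invertible blocks, the same fraction as the class of
  d among the matrices of size n, and the two cancel.\<close>

lemma mean_card_embeddings:
  fixes M :: "'a::{field,finite} mat"
  assumes M: "M \<in> carrier_mat m m" "det M \<noteq> 0" and "m < n" "d \<noteq> 0"
  shows "(\<Sum>A\<in>det_set n d. card (embeddings A M)) = card (det_set n d)"
proof -
  define k where "k = n - m"
  have n: "n = m + k" "0 < k" "0 < n" using \<open>m < n\<close> by (auto simp: k_def)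
  have e: "d / det M \<noteq> 0" using assms by simp
  let ?x = "(CARD('a) - 1) * card (det_set k (d / det M))"
  have "{B \<in> carrier_mat k k. det M * det B = d} = det_set k (d / det M)"
    using M(2) by (auto simp: det_set_def field_simps)
  then have "(\<Sum>A\<in>det_set n d. card (embeddings A M)) * ?x
      = ((CARD('a) - 1) * card (det_set n d)) * card (det_set k (d / det M))"
    using sum_card_embeddings[OF M(1), of k d] card_inv_set[OF n(2) e] card_inv_set[OF n(3) assms(4)]
    unfolding n(1) by simp
  then have "(\<Sum>A\<in>det_set n d. card (embeddings A M)) * ?x = card (det_set n d) * ?x"
    by (simp only: mult_ac)
  moreover have "0 < ?x"
    using inv_set_pos[of k, where 'a = 'a] card_inv_set[OF n(2) e] by simp
  ultimately show ?thesis unfolding mult_cancel2 by linarith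
qed

text \<open>For m = n the complementary block is empty and its determinant is 1, so the mean is q -
  1 or 0 according to whether det M = d; for m > n there are no embeddings. The tail estimate asks
  only for a bound that is uniform in M and n.\<close>

lemma mean_card_embeddings_le:
  fixes M :: "'a::{field,finite} mat"
  assumes M: "M \<in> carrier_mat m m" "det M \<noteq> 0" and "0 < n" "d \<noteq> 0"
  shows "(\<Sum>A\<in>det_set n d. card (embeddings A M)) \<le> CARD('a) * card (det_set n d)"
proof (cases "m \<le> n")
  case True
  define k where "k = n - m"
  have n: "n = m + k" using True by (simp add: k_def)
  have "{B \<in> carrier_mat k k. det M * det B = d} \<subseteq> inv_set k"
    using assms(4) by (auto simp: inv_set_def)
  then have "card {B \<in> carrier_mat k k. det M * det B = d} \<le> card (inv_set k :: 'a mat set)"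
    by (rule card_mono[rotated]) simp
  then have "(\<Sum>A\<in>det_set n d. card (embeddings A M)) * card (inv_set k :: 'a mat set)
      \<le> card (inv_set n :: 'a mat set) * card (inv_set k :: 'a mat set)"
    using sum_card_embeddings[OF M(1), of k d] unfolding n by simp
  then have "(\<Sum>A\<in>det_set n d. card (embeddings A M)) \<le> card (inv_set n :: 'a mat set)"
    using inv_set_pos[of k, where 'a = 'a] by simp
  also have "\<dots> \<le> CARD('a) * card (det_set n d)"
    unfolding card_inv_set[OF assms(3,4)] by (intro mult_right_mono) auto
  finally show ?thesis .
next
  case False
  have "embeddings A M = {}" if "A \<in> det_set n d" for A
    using that M False inj_mat_dim_le[of _ n m] by (fastforce simp: embeddings_def det_set_def)
  then show ?thesis by simp
qed

subsection \<open>Kernels and the characteristic polynomial\<close>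

abbreviation const_mat :: "'a::comm_ring_1 mat \<Rightarrow> 'a poly mat" where
  "const_mat \<equiv> map_mat (\<lambda>a. [:a:])"

lemma const_mat_mult:
  fixes A B :: "'a::comm_ring_1 mat"
  assumes "A \<in> carrier_mat n m" "B \<in> carrier_mat m k"
  shows "const_mat (A * B) = const_mat A * const_mat B"
proof -
  interpret semiring_hom "\<lambda>a::'a. [:a:]" by unfold_locales (auto simp: one_pCons)
  show ?thesis by (rule mat_hom_mult[OF assms])
qed

lemma char_poly_matrix_diff:
  fixes A :: "'a::comm_ring_1 mat"
  assumes "A \<in> carrier_mat n n"
  shows "char_poly_matrix A = [:0, 1:] \<cdot>\<^sub>m 1\<^sub>m n - const_mat A"
  using assms by (auto simp: char_poly_matrix_def intro!: eq_matI)

lemma char_poly_matrix_dim [simp]: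
  "dim_row (char_poly_matrix A) = dim_row A" "dim_col (char_poly_matrix A) = dim_col A"
  if "A \<in> carrier_mat n n"
  using char_poly_matrix_closed[OF that] that by (metis carrier_matD)+

text \<open>The matrix form of the fact that x - a divides p(x) - p(a).\<close>

lemma poly_minus_poly_mat_factor:
  fixes A :: "'a::comm_ring_1 mat"
  assumes A: "A \<in> carrier_mat n n"
  shows "\<exists>G\<in>carrier_mat n n. p \<cdot>\<^sub>m 1\<^sub>m n - const_mat (poly_mat p A) = char_poly_matrix A * G"
proof (induction p)
  case 0
  have "0 \<cdot>\<^sub>m 1\<^sub>m n - const_mat (poly_mat 0 A) = char_poly_matrix A * 0\<^sub>m n n"
    using A by (auto intro!: eq_matI)
  then show ?case by (intro bexI[of _ "0\<^sub>m n n"]) auto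
next
  case (pCons a p)
  let ?X = "char_poly_matrix A" and ?L = "const_mat A" and ?P = "const_mat (poly_mat p A)"
  let ?x = "[:0, 1:] :: 'a poly" let ?I = "1\<^sub>m n :: 'a poly mat"
  from pCons obtain G where G: "G \<in> carrier_mat n n" "p \<cdot>\<^sub>m ?I - ?P = ?X * G" by blast
  have c: "?X \<in> carrier_mat n n" "?L \<in> carrier_mat n n" "?P \<in> carrier_mat n n" using A by auto
  have xI: "q \<cdot>\<^sub>m ?I \<in> carrier_mat n n" for q by simp
  have XL: "?X * ?L = ?L * ?X"
    unfolding char_poly_matrix_diff[OF A] minus_mult_distrib_mat[OF xI c(2,2)]
      mult_minus_distrib_mat[OF c(2) xI c(2)] mult_smult_distrib[OF c(2) one_carrier_mat]
      mult_smult_assoc_mat[OF one_carrier_mat c(2)] using c(2) by simp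
  have "const_mat (poly_mat (pCons a p) A) = [:a:] \<cdot>\<^sub>m ?I + ?L * ?P"
    unfolding poly_mat_pCons[OF A] const_mat_mult[OF A poly_mat_carrier[OF A], symmetric]
    using A poly_mat_carrier[OF A] by (auto intro!: eq_matI)
  then have "pCons a p \<cdot>\<^sub>m ?I - const_mat (poly_mat (pCons a p) A) = (?x * p) \<cdot>\<^sub>m ?I - ?L * ?P"
    using c by (auto intro!: eq_matI)
  \<comment> \<open>This is x p(x) - a p(a) = (x - a) p(x) + a (p(x) - p(a)). \<open>XL\<close> then
    moves the factor A past xI - A, so that the latter stays on the left.\<close>
  also have "\<dots> = ?X * (p \<cdot>\<^sub>m ?I) + ?L * (p \<cdot>\<^sub>m ?I - ?P)"
  proof -
    have "?X * (p \<cdot>\<^sub>m ?I) = (?x * p) \<cdot>\<^sub>m ?I - p \<cdot>\<^sub>m ?L"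
      using c by (auto simp: mult_smult_distrib[OF c(1) one_carrier_mat] char_poly_matrix_diff[OF A]
        algebra_simps intro!: eq_matI)
    moreover have "?L * (p \<cdot>\<^sub>m ?I - ?P) = p \<cdot>\<^sub>m ?L - ?L * ?P"
      unfolding mult_minus_distrib_mat[OF c(2) xI c(3)] mult_smult_distrib[OF c(2) one_carrier_mat]
      using c(2) by simp
    ultimately show ?thesis using c by (auto intro!: eq_matI)
  qed
  also have "\<dots> = ?X * (p \<cdot>\<^sub>m ?I) + ?X * (?L * G)"
    unfolding G(2) by (simp add: assoc_mult_mat[OF c(2,1) G(1), symmetric] assoc_mult_mat[OF c(1,2) G(1), symmetric] XL)
  also have "\<dots> = ?X * (p \<cdot>\<^sub>m ?I + ?L * G)"
    by (rule mult_add_distrib_mat[symmetric]) (use c G in auto)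
  finally show ?case by (intro bexI[of _ "p \<cdot>\<^sub>m ?I + ?L * G"]) (use c G in auto)
qed

text \<open>A nonzero right factor \<open>H\<close> would make the product non-constant: look at the highest degree
  occurring in \<open>H\<close>.\<close>

lemma char_poly_matrix_mult_const_imp_0:
  fixes A N :: "'a::comm_ring_1 mat"
  assumes A: "A \<in> carrier_mat n n" and H: "H \<in> carrier_mat n n" and N: "N \<in> carrier_mat n n"
    and eq: "const_mat N = char_poly_matrix A * H"
  shows "N = 0\<^sub>m n n"
proof -
  \<comment> \<open>Coefficients are compared in degree k + 1, where the constant matrix N
    contributes nothing.\<close>
  have coeff_step: "coeff (H $$ (i,j)) k = (\<Sum>l<n. A $$ (i,l) * coeff (H $$ (l,j)) (Suc k))"
    if "i < n" "j < n" for i j k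
  proof -
    have "char_poly_matrix A * H = [:0, 1:] \<cdot>\<^sub>m H - const_mat A * H"
    proof -
      have c: "[:0, 1:] \<cdot>\<^sub>m 1\<^sub>m n \<in> carrier_mat n n" "const_mat A \<in> carrier_mat n n" using A by auto
      show ?thesis
        unfolding char_poly_matrix_diff[OF A] minus_mult_distrib_mat[OF c H]
          mult_smult_assoc_mat[OF one_carrier_mat H] using H by simp
    qed
    then have "[:N $$ (i,j):] = [:0, 1:] * H $$ (i,j) - (\<Sum>l<n. [:A $$ (i,l):] * H $$ (l,j))"
      using arg_cong[OF eq, of "\<lambda>Z. Z $$ (i,j)"] that A H N
      by (simp add: scalar_prod_def lessThan_atLeast0)
    from arg_cong[OF this, of "\<lambda>p. coeff p (Suc k)"] show ?thesis
      by (simp add: coeff_sum)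
  qed
  have H0: "coeff (H $$ (i,j)) k = 0" if "i < n" "j < n" for i j k
  proof -
    define D where "D = (\<Sum>ij\<in>{..<n} \<times> {..<n}. degree (H $$ ij))"
    have deg: "degree (H $$ (i,j)) \<le> D" if "i < n" "j < n" for i j
      unfolding D_def using that by (intro member_le_sum[of "(i,j)" _ "\<lambda>ij. degree (H $$ ij)"]) auto
    have "\<forall>i<n. \<forall>j<n. coeff (H $$ (i,j)) (Suc D - m) = 0" if "m \<le> Suc D" for m
      using that
    proof (induction m)
      case 0
      then show ?case using deg by (auto intro!: coeff_eq_0 simp: less_Suc_eq_le)
    next
      case (Suc m)
      then have S: "Suc (Suc D - Suc m) = Suc D - m" by simp
      have "coeff (H $$ (i,j)) (Suc D - Suc m) = 0" if ij: "i < n" "j < n" for i j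
        unfolding coeff_step[OF ij] S using Suc ij by (intro sum.neutral) auto
      then show ?case by blast
    qed
    from this[of "Suc D - k"] that show ?thesis
      using deg[OF that] by (cases "k \<le> Suc D") (auto intro!: coeff_eq_0)
  qed
  have "H = 0\<^sub>m n n" using H H0 by (auto intro!: eq_matI poly_eqI)
  then have *: "const_mat N = 0\<^sub>m n n" using eq A by simp
  show ?thesis
  proof (rule eq_matI)
    fix i j assume "i < dim_row (0\<^sub>m n n :: 'a mat)" "j < dim_col (0\<^sub>m n n :: 'a mat)"
    then show "N $$ (i,j) = 0\<^sub>m n n $$ (i,j)" using arg_cong[OF *, of "\<lambda>Z. Z $$ (i,j)"] N by simp
  qed (use N in auto)
qed

text \<open>Modulo left multiples of xI - A, the matrix p(x) I equals p(A). For the characteristic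
  polynomial it is also 0, by the adjugate. A constant matrix that is a left multiple of xI - A
  vanishes.\<close>

lemma cayley_hamilton:
  fixes A :: "'a::comm_ring_1 mat"
  assumes A: "A \<in> carrier_mat n n"
  shows "poly_mat (char_poly A) A = 0\<^sub>m n n"
proof -
  let ?X = "char_poly_matrix A" let ?p = "char_poly A"
  have X: "?X \<in> carrier_mat n n" using A by simp
  have P: "poly_mat ?p A \<in> carrier_mat n n" using A by simp
  obtain G where G: "G \<in> carrier_mat n n" "?p \<cdot>\<^sub>m 1\<^sub>m n - const_mat (poly_mat ?p A) = ?X * G"
    using poly_minus_poly_mat_factor[OF A] by blast
  have adj: "?X * adj_mat ?X = ?p \<cdot>\<^sub>m 1\<^sub>m n" "adj_mat ?X \<in> carrier_mat n n"
    using adj_mat[OF X] by (simp_all add: char_poly_def)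
  have "const_mat (poly_mat ?p A) = ?p \<cdot>\<^sub>m 1\<^sub>m n - (?p \<cdot>\<^sub>m 1\<^sub>m n - const_mat (poly_mat ?p A))"
    using P by (auto intro!: eq_matI)
  also have "\<dots> = ?X * adj_mat ?X - ?X * G" unfolding G(2) adj(1) ..
  also have "\<dots> = ?X * (adj_mat ?X - G)"
    by (rule mult_minus_distrib_mat[OF X adj(2) G(1), symmetric])
  finally have *: "const_mat (poly_mat ?p A) = ?X * (adj_mat ?X - G)" .
  have H: "adj_mat ?X - G \<in> carrier_mat n n" by (rule minus_carrier_mat[OF G(1)])
  show ?thesis by (rule char_poly_matrix_mult_const_imp_0[OF A H P *])
qed

text \<open>Substituting f for x is a ring homomorphism, so it commutes with the determinant of xI -
  A.\<close>

lemma char_poly_pcompose: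
  fixes A :: "'a::comm_ring_1 mat"
  assumes A: "A \<in> carrier_mat n n"
  shows "det (f \<cdot>\<^sub>m 1\<^sub>m n - const_mat A) = char_poly A \<circ>\<^sub>p f"
proof -
  have "map_mat (\<lambda>q. q \<circ>\<^sub>p f) (char_poly_matrix A) = f \<cdot>\<^sub>m 1\<^sub>m n - const_mat A"
    unfolding char_poly_matrix_diff[OF A] using A
    by (auto simp: pcompose_diff pcompose_pCons intro!: eq_matI)
  then show ?thesis unfolding char_poly_def comm_ring_hom.hom_det[OF pcompose_hom.comm_ring_hom_axioms, symmetric] by simp
qed

text \<open>No splitting field is used. In one direction, xI - A divides f(x) I - f(A), and taking
  determinants relates the characteristic polynomials of A and f(A). In the other, Cayley-Hamilton
  meets a Bezout coefficient: if f did not divide the characteristic polynomial, the latter would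
  act invertibly on the kernel of f(A), but it acts as 0.\<close>

lemma dvd_char_poly_iff:
  fixes A :: "'a::field mat"
  assumes A: "A \<in> carrier_mat n n" and f: "irreducible f"
  shows "f dvd char_poly A \<longleftrightarrow> poly_kernel f A \<noteq> {0\<^sub>v n}"
proof
  assume dvd: "f dvd char_poly A"
  let ?F = "poly_mat f A"
  have F: "?F \<in> carrier_mat n n" using A by simp
  obtain G where G: "G \<in> carrier_mat n n" "f \<cdot>\<^sub>m 1\<^sub>m n - const_mat ?F = char_poly_matrix A * G"
    using poly_minus_poly_mat_factor[OF A] by blast
  have "char_poly ?F \<circ>\<^sub>p f = char_poly A * det G"
    unfolding char_poly_pcompose[OF F, symmetric] G(2) char_poly_def[of A]
    by (rule det_mult) (use A G in auto)
  then have dvd': "f dvd char_poly ?F \<circ>\<^sub>p f" using dvd by simp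
  obtain c r where cr: "char_poly ?F = pCons c r" by (cases "char_poly ?F")
  \<comment> \<open>Modulo f, a polynomial in f reduces to its constant coefficient. Here this is
    the characteristic polynomial of f(A) at 0, so f(A) has eigenvalue 0 as soon as it
    vanishes.\<close>
  have "f dvd [:c:]"
    using dvd' unfolding cr pcompose_pCons by (simp add: dvd_add_left_iff)
  then have "c = 0"
    using dvd_imp_degree_le[of f "[:c:]"] irreducible_poly_degree_pos[OF f] by (cases "c = 0") auto
  then have "poly (char_poly ?F) 0 = 0" unfolding cr by simp
  then have "eigenvalue ?F 0" using eigenvalue_root_char_poly[OF F] by simp
  then obtain v where "v \<in> carrier_vec n" "v \<noteq> 0\<^sub>v n" "?F *\<^sub>v v = 0 \<cdot>\<^sub>v v"
    using F by (auto simp: eigenvalue_def eigenvector_def)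
  moreover from this have "?F *\<^sub>v v = 0\<^sub>v n" by (auto intro!: eq_vecI)
  ultimately show "poly_kernel f A \<noteq> {0\<^sub>v n}" using A by (auto simp: poly_kernel_def)
next
  assume ker: "poly_kernel f A \<noteq> {0\<^sub>v n}"
  have P: "poly_mat q A \<in> carrier_mat n n" for q using A by simp
  have "0\<^sub>v n \<in> poly_kernel f A" using A by (auto simp: poly_kernel_def mult_mat_zero_vec[OF P])
  with ker obtain v where v: "v \<in> carrier_vec n" "v \<noteq> 0\<^sub>v n" "poly_mat f A *\<^sub>v v = 0\<^sub>v n"
    using A by (auto simp: poly_kernel_def)
  show "f dvd char_poly A"
  proof (rule ccontr)
    assume "\<not> f dvd char_poly A"
    from poly_mat_invertible_on_kernel[OF f this] obtain a where
      "\<And>n A' v. A' \<in> carrier_mat n n \<Longrightarrow> v \<in> carrier_vec n \<Longrightarrow> poly_mat f A' *\<^sub>v v = 0\<^sub>v n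
      \<Longrightarrow> poly_mat a A' *\<^sub>v (poly_mat (char_poly A) A' *\<^sub>v v) = v" by blast
    from this[OF A v(1,3)] have "poly_mat a A *\<^sub>v (0\<^sub>m n n *\<^sub>v v) = v"
      unfolding cayley_hamilton[OF A] .
    moreover have "0\<^sub>m n n *\<^sub>v v = 0\<^sub>v n" using v(1) by (auto intro!: eq_vecI)
    ultimately show False using v(2) mult_mat_zero_vec[OF P] by simp
  qed
qed

definition small_irreducibles :: "nat \<Rightarrow> 'a::field poly set" where
  "small_irreducibles t = {f. monic_irreducible f \<and> coeff f 0 \<noteq> 0 \<and> degree f \<le> t}"

text \<open>An arbitrary irreducible factor may be scaled to be monic. A zero constant term would
  make 0 an eigenvalue, against invertibility.\<close>

lemma no_irred_factor_upto_iff: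
  fixes A :: "'a::field mat"
  assumes A: "A \<in> carrier_mat n n" and det: "det A \<noteq> 0"
  shows "no_irred_factor_upto t (char_poly A) \<longleftrightarrow> (\<forall>f\<in>small_irreducibles t. poly_kernel f A = {0\<^sub>v n})"
proof
  assume "no_irred_factor_upto t (char_poly A)"
  then show "\<forall>f\<in>small_irreducibles t. poly_kernel f A = {0\<^sub>v n}"
    using dvd_char_poly_iff[OF A] by (auto simp: no_irred_factor_upto_def small_irreducibles_def monic_irreducible_def)
next
  assume ker: "\<forall>f\<in>small_irreducibles t. poly_kernel f A = {0\<^sub>v n}"
  show "no_irred_factor_upto t (char_poly A)"
    unfolding no_irred_factor_upto_def
  proof clarify
    fix f :: "'a poly" assume f: "irreducible f" "f dvd char_poly A" "degree f \<le> t"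
    define g where "g = Polynomial.smult (inverse (lead_coeff f)) f"
    have f0: "f \<noteq> 0" using f(1) by auto
    then have u: "inverse (lead_coeff f) \<noteq> 0" by simp
    have "g = [:inverse (lead_coeff f):] * f" by (simp add: g_def)
    then have "irreducible g" using f(1) u by (simp only: irreducible_mult_unit_left is_unit_const_poly_iff) simp
    with f f0 u have g: "irreducible g" "lead_coeff g = 1" "g dvd char_poly A" "degree g \<le> t"
      by (auto simp: g_def smult_dvd_iff)
    have "coeff g 0 \<noteq> 0"
    proof
      assume "coeff g 0 = 0"
      then have "poly g 0 = 0" by (simp add: poly_0_coeff_0)
      then have "poly (char_poly A) 0 = 0" using g(3) by (auto elim!: dvdE)
      then have "eigenvalue A 0" using eigenvalue_root_char_poly[OF A] by simp
      then obtain v where v: "v \<in> carrier_vec n" "v \<noteq> 0\<^sub>v n" "A *\<^sub>v v = 0 \<cdot>\<^sub>v v"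
        using A by (auto simp: eigenvalue_def eigenvector_def)
      moreover from this have "A *\<^sub>v v = 0\<^sub>v n" by (auto intro!: eq_vecI)
      ultimately show False using det det_0_iff_vec_prod_zero_field[OF A] by blast
    qed
    then have "g \<in> small_irreducibles t" using g by (simp add: small_irreducibles_def monic_irreducible_def)
    then show False using ker g dvd_char_poly_iff[OF A g(1)] by blast
  qed
qed

lemma count_list_replicate: "count_list (replicate k x) y = (if x = y then k else 0)"
  by (induction k) auto

text \<open>For dimension reasons \<open>n + 1\<close> copies of \<open>companion f\<close> do not embed into \<open>A\<close>, so one factor of the
  product formula for the number of embeddings vanishes.\<close>

lemma card_poly_kernel_power:
  fixes A :: "'a::{field,finite} mat"
  assumes A: "A \<in> carrier_mat n n" and f: "monic_irreducible f"
  shows "\<exists>m\<le>n. card (poly_kernel f A) = (CARD('a) ^ degree f) ^ m"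
proof -
  let ?fs = "replicate (Suc n) f"
  have d: "0 < degree f" using f irreducible_poly_degree_pos by (auto simp: monic_irreducible_def)
  have dim: "companion_sum ?fs \<in> carrier_mat (Suc n * degree f) (Suc n * degree f)"
    using companion_sum_carrier[of ?fs] by (simp add: sum_list_replicate)
  have "embeddings A (companion_sum ?fs) = {}"
  proof (rule ccontr)
    assume "embeddings A (companion_sum ?fs) \<noteq> {}"
    then obtain X where "X \<in> embeddings A (companion_sum ?fs)" by blast
    then have "X \<in> carrier_mat n (Suc n * degree f)" "inj_mat X"
      using carrier_matD(1)[OF A] carrier_matD(1)[OF dim] by (simp_all only: embeddings_def mem_Collect_eq)
    then have "Suc n * degree f \<le> n" using inj_mat_dim_le by blast
    moreover have "Suc n * 1 \<le> Suc n * degree f" using d by (intro mult_left_mono) auto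
    ultimately show False by simp
  qed
  then have "(\<Prod>i<Suc n. int (card (poly_kernel f A)) - int ((CARD('a) ^ degree f) ^ i)) = 0"
    using card_embeddings_companion_sum_list[OF A, of "{f}" ?fs] f
    by (simp add: count_list_replicate del: of_nat_power lessThan_Suc replicate_Suc)
  \<comment> \<open>The index of a vanishing factor is the dimension of the kernel over the field
    K[x]/(f), found here without introducing that vector space structure.\<close>
  then obtain i where "i < Suc n" "int (card (poly_kernel f A)) = int ((CARD('a) ^ degree f) ^ i)"
    unfolding prod_zero_iff[OF finite_lessThan] by auto
  then show ?thesis by (auto simp only: of_nat_eq_iff less_Suc_eq_le)
qed

subsection \<open>Euler's identity\<close>

text \<open>This is (-1)^r Q^(r(r-1)/2) divided by the order of GL_r(Q). The falling product counts
  injections from dimension r to dimension m, so coefficient times falling product is a sum of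
  Moebius values over the r-dimensional subspaces: the expansion is Moebius inversion in the lattice
  of subspaces of the kernel.\<close>

definition euler_coeff :: "real \<Rightarrow> nat \<Rightarrow> real" where
  "euler_coeff Q r = (- 1) ^ r / (\<Prod>i=1..r. Q ^ i - 1)"

lemma euler_coeff_0 [simp]: "euler_coeff Q 0 = 1"
  by (simp add: euler_coeff_def)

lemma euler_coeff_Suc: "euler_coeff Q (Suc r) = - euler_coeff Q r / (Q ^ Suc r - 1)"
  by (simp add: euler_coeff_def)

lemma power_minus_1_pos: "1 < Q \<Longrightarrow> 0 < i \<Longrightarrow> 0 < Q ^ i - (1::real)"
  by (simp add: one_less_power)

text \<open>For every x the truncated sum is itself a product, which lets the induction on N close.
  As a polynomial in x it is 1 at x = 1 and vanishes at Q, ..., Q^N, so on the powers Q^m with m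
  \<le> N it is the indicator of m = 0.\<close>

lemma sum_euler_coeff_falling:
  assumes Q: "1 < Q"
  shows "(\<Sum>r\<le>N. euler_coeff Q r * (\<Prod>i<r. x - Q ^ i)) = (\<Prod>i=1..N. (Q ^ i - x) / (Q ^ i - 1))"
proof (induction N)
  case 0
  then show ?case by simp
next
  case (Suc N)
  let ?a = "\<Prod>i=1..N. Q ^ i - x" and ?D = "\<Prod>i=1..N. Q ^ i - 1" and ?y = "Q ^ Suc N - 1"
  have "Q ^ i - 1 \<noteq> 0" if "i \<in> {1..N}" for i
    using power_minus_1_pos[OF Q, of i] that by auto
  then have D: "?D \<noteq> 0" by simp
  have y: "?y \<noteq> 0" using power_minus_1_pos[OF Q, of "Suc N"] by simp
  \<comment> \<open>With the factor for i = 0 split off and N signs reversed, the new term has the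
    numerator \<open>?a\<close> of the old product as a factor.\<close>
  have "(\<Prod>i<Suc N. x - Q ^ i) = (x - 1) * (\<Prod>i<N. x - Q ^ Suc i)"
    by (simp add: prod.lessThan_Suc_shift del: prod.lessThan_Suc)
  also have "(\<Prod>i<N. x - Q ^ Suc i) = (\<Prod>i=1..N. (- 1) * (Q ^ i - x))"
    by (rule prod.reindex_bij_witness[of _ "\<lambda>i. i - 1" Suc]) auto
  also have "\<dots> = (- 1) ^ N * ?a" by (simp only: prod.distrib prod_constant card_atLeastAtMost diff_Suc_1)
  finally have p: "(\<Prod>i<Suc N. x - Q ^ i) = (x - 1) * ((- 1) ^ N * ?a)" .
  have c: "euler_coeff Q (Suc N) = - ((- 1) ^ N) / (?D * ?y)" by (simp add: euler_coeff_def)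
  have "euler_coeff Q (Suc N) * (\<Prod>i<Suc N. x - Q ^ i)
      = - ((- 1) ^ N * (- 1) ^ N) * (x - 1) * ?a / (?D * ?y)"
    unfolding p c times_divide_eq_left by (simp only: mult_ac mult_minus_left mult_minus_right)
  also have "(- 1 :: real) ^ N * (- 1) ^ N = 1" by (simp add: power_mult_distrib[symmetric])
  finally have "(\<Sum>r\<le>Suc N. euler_coeff Q r * (\<Prod>i<r. x - Q ^ i)) = ?a / ?D + - 1 * (x - 1) * ?a / (?D * ?y)"
    using Suc by (simp add: prod_dividef)
  also have "\<dots> = ?a * (Q ^ Suc N - x) / (?D * ?y)" using D y by (simp add: field_simps)
  also have "\<dots> = (\<Prod>i=1..Suc N. (Q ^ i - x) / (Q ^ i - 1))" by (simp add: prod_dividef)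
  finally show ?case .
qed

lemma sum_euler_coeff_indicator:
  assumes Q: "1 < Q" and "m \<le> N"
  shows "(\<Sum>r\<le>N. euler_coeff Q r * (\<Prod>i<r. Q ^ m - Q ^ i)) = (if m = 0 then 1 else 0)"
proof (cases "m = 0")
  case True
  have "(Q ^ i - Q ^ 0) / (Q ^ i - 1) = 1" if "i \<in> {1..N}" for i
    using power_minus_1_pos[OF Q, of i] that by auto
  then show ?thesis unfolding sum_euler_coeff_falling[OF Q] using True by simp
next
  case False
  then have "m \<in> {1..N}" using assms by auto
  then have "\<exists>i\<in>{1..N}. (Q ^ i - Q ^ m) / (Q ^ i - 1) = 0" by force
  then show ?thesis unfolding sum_euler_coeff_falling[OF Q] using False by (simp add: prod_zero_iff)
qed

text \<open>Successive coefficients shrink by Q^(r+1) - 1, so the radius of convergence is infinite.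
  The tail estimate uses this at z = 2 ^ degree f, beyond the point 1 of Euler's identity.\<close>

lemma summable_abs_euler_coeff:
  assumes Q: "1 < Q"
  shows "summable (\<lambda>r. \<bar>euler_coeff Q r\<bar> * \<bar>z\<bar> ^ r)"
proof -
  \<comment> \<open>From this N on, Q^(n+1) - 1 is at least 2 |z|, so each term is at most half of
    the preceding one.\<close>
  from real_arch_pow[OF Q, of "1 + 2 * \<bar>z\<bar>"] obtain N where N: "1 + 2 * \<bar>z\<bar> < Q ^ N" by blast
  show ?thesis
  proof (rule summable_ratio_test[of "1/2" N])
    fix n assume n: "n \<ge> N"
    have "Q ^ N \<le> Q ^ Suc n" using Q n by (intro power_increasing) auto
    then have le: "2 * \<bar>z\<bar> \<le> Q ^ Suc n - 1" using N by simp
    have pos: "0 < Q ^ Suc n - 1" by (rule power_minus_1_pos[OF Q]) simp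
    have "\<bar>euler_coeff Q (Suc n)\<bar> * \<bar>z\<bar> ^ Suc n = (\<bar>z\<bar> / (Q ^ Suc n - 1)) * (\<bar>euler_coeff Q n\<bar> * \<bar>z\<bar> ^ n)"
      using pos by (simp add: euler_coeff_Suc abs_divide)
    also have "\<dots> \<le> (1/2) * (\<bar>euler_coeff Q n\<bar> * \<bar>z\<bar> ^ n)"
      using le pos by (intro mult_right_mono) (auto simp: field_simps)
    finally show "norm (\<bar>euler_coeff Q (Suc n)\<bar> * \<bar>z\<bar> ^ Suc n) \<le> 1/2 * norm (\<bar>euler_coeff Q n\<bar> * \<bar>z\<bar> ^ n)"
      by (simp add: abs_mult)
  qed simp
qed

lemma summable_euler_coeff:
  assumes Q: "1 < Q"
  shows "summable (\<lambda>r. euler_coeff Q r * z ^ r)"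
  by (rule summable_rabs_cancel) (use summable_abs_euler_coeff[OF Q, of z] in \<open>simp add: abs_mult power_abs\<close>)

lemma convergent_prod_euler:
  fixes Q :: real
  assumes Q: "1 < Q"
  shows "convergent_prod (\<lambda>i. 1 - 1 / Q ^ Suc i)"
proof -
  have "norm (1 / Q) < 1" using Q by simp
  then have "summable (\<lambda>i. (1 / Q) * (1 / Q) ^ i)"
    by (intro summable_mult summable_geometric)
  then have "summable (\<lambda>i. norm ((1 - 1 / Q ^ Suc i) - 1))" using Q by (simp add: power_divide)
  then show ?thesis
    by (intro abs_convergent_prod_imp_convergent_prod) (simp add: abs_convergent_prod_conv_summable)
qed

text \<open>Euler's product expansion, from the functional equation \<open>f(Qu) = (1 - u) f(u)\<close> of
  \<open>f(u) = \<Sum>r. euler_coeff Q r u\<^sup>r\<close>.\<close>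

lemma euler_product:
  assumes Q: "1 < Q"
  shows "(\<lambda>N. \<Sum>r\<le>N. euler_coeff Q r) \<longlonglongrightarrow> (\<Prod>i. 1 - 1 / Q ^ Suc i)"
proof -
  define f where "f u = (\<Sum>r. euler_coeff Q r * u ^ r)" for u
  note sm = summable_euler_coeff[OF Q]
  have step: "f (Q * u) = (1 - u) * f u" for u
  proof -
    have "f (Q * u) - f u = (\<Sum>r. euler_coeff Q r * (Q * u) ^ r - euler_coeff Q r * u ^ r)"
      unfolding f_def by (rule suminf_diff[OF sm sm])
    also have "\<dots> = (\<Sum>r. euler_coeff Q (Suc r) * (Q * u) ^ Suc r - euler_coeff Q (Suc r) * u ^ Suc r)"
      by (subst suminf_split_head) (auto intro: summable_diff sm)
    also have "\<dots> = (\<Sum>r. - u * (euler_coeff Q r * u ^ r))"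
    proof (rule suminf_cong)
      fix r
      have "Q ^ Suc r - 1 \<noteq> 0" using power_minus_1_pos[OF Q, of "Suc r"] by simp
      then have e: "euler_coeff Q (Suc r) * (Q ^ Suc r - 1) = - euler_coeff Q r"
        by (simp add: euler_coeff_Suc)
      have "euler_coeff Q (Suc r) * (Q * u) ^ Suc r - euler_coeff Q (Suc r) * u ^ Suc r
          = (euler_coeff Q (Suc r) * (Q ^ Suc r - 1)) * u ^ Suc r"
        unfolding power_mult_distrib by (simp only: algebra_simps)
      then show "euler_coeff Q (Suc r) * (Q * u) ^ Suc r - euler_coeff Q (Suc r) * u ^ Suc r
          = - u * (euler_coeff Q r * u ^ r)" unfolding e by simp
    qed
    also have "\<dots> = - u * f u" unfolding f_def by (rule suminf_mult[OF sm])
    finally show ?thesis by (simp add: algebra_simps)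
  qed
  \<comment> \<open>The functional equation is applied N times downwards from u = 1. The remaining
    argument 1 / Q^N tends to 0, where f is continuous with value 1.\<close>
  have iter: "f 1 = (\<Prod>i<N. 1 - 1 / Q ^ Suc i) * f (1 / Q ^ N)" for N
  proof (induction N)
    case (Suc N)
    have "f (1 / Q ^ N) = (1 - 1 / Q ^ Suc N) * f (1 / Q ^ Suc N)"
      using step[of "1 / Q ^ Suc N"] Q by simp
    then show ?case using Suc by simp
  qed simp
  have "isCont f 0"
    unfolding f_def by (rule isCont_powser[OF sm[of 1]]) simp
  moreover have "(\<lambda>N. 1 / Q ^ N) \<longlonglongrightarrow> 0"
    using LIMSEQ_inverse_realpow_zero[OF Q] by (simp add: inverse_eq_divide)
  ultimately have "(\<lambda>N. f (1 / Q ^ N)) \<longlonglongrightarrow> f 0" by (rule isCont_tendsto_compose)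
  moreover have "f 0 = 1" unfolding f_def by (subst powser_zero) simp
  ultimately have lim1: "(\<lambda>N. f (1 / Q ^ N)) \<longlonglongrightarrow> 1" by simp
  have lim2: "(\<lambda>N. \<Prod>i<N. 1 - 1 / Q ^ Suc i) \<longlonglongrightarrow> (\<Prod>i. 1 - 1 / Q ^ Suc i)"
    using convergent_prod_LIMSEQ[OF convergent_prod_euler[OF Q]]
    by (subst LIMSEQ_lessThan_iff_atMost)
  from tendsto_mult[OF lim2 lim1] have "(\<lambda>N. f 1) \<longlonglongrightarrow> (\<Prod>i. 1 - 1 / Q ^ Suc i)"
    unfolding iter[symmetric] by simp
  then have "f 1 = (\<Prod>i. 1 - 1 / Q ^ Suc i)" by (simp add: LIMSEQ_const_iff)
  then show ?thesis using summable_LIMSEQ'[OF sm[of 1]] unfolding f_def by simp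
qed

section \<open>The finite index set of irreducibles and its grouping by degree\<close>

lemma finite_poly_degree_le: "finite {p :: 'a::{zero,finite} poly. degree p \<le> t}"
proof -
  have "inj_on (\<lambda>p. \<lambda>i\<in>{..t}. coeff p i) {p :: 'a poly. degree p \<le> t}"
  proof (rule inj_onI, rule poly_eqI)
    fix p q :: "'a poly" and i
    assume *: "p \<in> {p. degree p \<le> t}" "q \<in> {p. degree p \<le> t}"
      "(\<lambda>i\<in>{..t}. coeff p i) = (\<lambda>i\<in>{..t}. coeff q i)"
    show "coeff p i = coeff q i"
      using fun_cong[OF *(3), of i] *(1,2) by (cases "i \<le> t") (auto simp: coeff_eq_0)
  qed
  moreover have "(\<lambda>p. \<lambda>i\<in>{..t}. coeff p i) ` {p :: 'a poly. degree p \<le> t} \<subseteq> (PiE {..t} (\<lambda>_. UNIV))"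
    by (intro image_subsetI) (simp add: restrict_PiE_iff)
  ultimately show ?thesis by (rule inj_on_finite) (simp add: finite_PiE)
qed

lemma finite_small_irreducibles [simp]: "finite (small_irreducibles t :: 'a::{field,finite} poly set)"
  by (rule finite_subset[OF _ finite_poly_degree_le[of t]]) (auto simp: small_irreducibles_def)

text \<open>The factor of f depends only on its degree, so the exponent N(q;j) turns into a product
  over the irreducibles of degree j, once it has been pulled out of the convergent infinite
  product.\<close>

lemma prodinf_by_degree:
  fixes q t :: nat
  assumes "1 < q"
  shows "(\<Prod>j=1..t. \<Prod>i. (1 - 1 / real q ^ (Suc i * j)) ^ num_irred TYPE('a::{field,finite}) j)
    = (\<Prod>f\<in>(small_irreducibles t :: 'a poly set). \<Prod>i. 1 - 1 / (real q ^ degree f) ^ Suc i)"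
proof -
  let ?\<Phi> = "small_irreducibles t :: 'a poly set"
  let ?P = "\<lambda>j. \<Prod>i. 1 - 1 / (real q ^ j) ^ Suc i"
  have deg: "degree f \<in> {1..t}" if "f \<in> ?\<Phi>" for f
    using that irreducible_poly_degree_pos[of f] by (auto simp: small_irreducibles_def monic_irreducible_def Suc_le_eq)
  have "(\<Prod>i. (1 - 1 / real q ^ (Suc i * j)) ^ num_irred TYPE('a) j) = (\<Prod>f\<in>{f \<in> ?\<Phi>. degree f = j}. ?P (degree f))"
    if j: "j \<in> {1..t}" for j
  proof -
    have Q: "1 < real q ^ j" using assms j by (auto intro!: one_less_power)
    have "{f \<in> ?\<Phi>. degree f = j} = {f. lead_coeff f = 1 \<and> irreducible f \<and> degree f = j \<and> coeff f 0 \<noteq> 0}"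
      using j by (auto simp: small_irreducibles_def monic_irreducible_def)
    then have N: "num_irred TYPE('a) j = card {f \<in> ?\<Phi>. degree f = j}" by (simp add: num_irred_def)
    have "real q ^ (Suc i * j) = (real q ^ j) ^ Suc i" for i
      by (subst mult.commute) (rule power_mult)
    then have "(\<Prod>i. (1 - 1 / real q ^ (Suc i * j)) ^ num_irred TYPE('a) j) = ?P j ^ num_irred TYPE('a) j"
      using prodinf_power[OF convergent_prod_euler[OF Q], of "num_irred TYPE('a) j"] by (simp only:)
    then show ?thesis unfolding N by simp
  qed
  then have "(\<Prod>j=1..t. \<Prod>i. (1 - 1 / real q ^ (Suc i * j)) ^ num_irred TYPE('a) j)
      = (\<Prod>j=1..t. \<Prod>f\<in>{f \<in> ?\<Phi>. degree f = j}. ?P (degree f))" by (rule prod.cong[OF refl])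
  also have "\<dots> = (\<Prod>f\<in>?\<Phi>. ?P (degree f))"
    by (rule prod.group) (use deg in auto)
  finally show ?thesis .
qed

text \<open>Converts a multiplicity function, the index of the expanded product, into a list on
  which \<open>companion_sum\<close> can recurse; the weight h becomes its dimension.\<close>

lemma exists_list_with_counts:
  fixes h :: "'b \<Rightarrow> nat"
  assumes "finite \<Phi>"
  shows "\<exists>fs. set fs \<subseteq> \<Phi> \<and> (\<forall>f\<in>\<Phi>. count_list fs f = g f)
    \<and> sum_list (map h fs) = (\<Sum>f\<in>\<Phi>. g f * h f)"
  using assms
proof induction
  case (insert x \<Phi>)
  then obtain fs where fs: "set fs \<subseteq> \<Phi>" "\<forall>f\<in>\<Phi>. count_list fs f = g f"
    "sum_list (map h fs) = (\<Sum>f\<in>\<Phi>. g f * h f)" by blast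
  have "x \<notin> set fs" using fs(1) insert.hyps(2) by auto
  then show ?case using fs insert.hyps
    by (intro exI[of _ "replicate (g x) x @ fs"])
       (auto simp: count_list_replicate count_list_0_iff sum_list_replicate)
qed simp

subsection \<open>The limit of the proportion\<close>

text \<open>The kernel has Q^m elements with m \<le> n, so truncation at n is exact. The cut-off is
  the same for all A and f, which makes the terms comparable when averaged.\<close>

lemma indicator_expansion:
  fixes A :: "'a::{field,finite} mat"
  assumes A: "A \<in> carrier_mat n n" and f: "monic_irreducible f"
  shows "(\<Sum>r\<le>n. euler_coeff (real CARD('a) ^ degree f) r
      * (\<Prod>i<r. real (card (poly_kernel f A)) - (real CARD('a) ^ degree f) ^ i))
    = of_bool (poly_kernel f A = {0\<^sub>v n})"
proof -
  let ?Q = "real CARD('a) ^ degree f"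
  have q: "1 < CARD('a)" using card_mono[of "UNIV :: 'a set" "{0,1}"] by simp
  then have Q: "1 < ?Q" using irreducible_poly_degree_pos[of f] f
    by (intro one_less_power) (auto simp: monic_irreducible_def)
  from card_poly_kernel_power[OF A f] obtain m where
    m: "m \<le> n" "card (poly_kernel f A) = (CARD('a) ^ degree f) ^ m" by blast
  have "0\<^sub>v n \<in> poly_kernel f A"
    using A by (auto simp: poly_kernel_def mult_mat_zero_vec[OF poly_mat_carrier[OF A]])
  then have "poly_kernel f A = {0\<^sub>v n} \<longleftrightarrow> card (poly_kernel f A) = 1"
    by (metis card_1_singletonE is_singletonI is_singleton_altdef singletonD)
  also have "\<dots> \<longleftrightarrow> ?Q ^ m = 1" unfolding m(2) by (metis of_nat_1 of_nat_eq_iff of_nat_power)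
  also have "\<dots> \<longleftrightarrow> m = 0" using one_less_power[OF Q, of m] by (cases "m = 0") auto
  finally show ?thesis
    using sum_euler_coeff_indicator[OF Q m(1)] unfolding m(2) by simp
qed

text \<open>The weight \<open>2 ^ w\<close> pays for the terms with \<open>w \<ge> n\<close>, which then contribute at most \<open>1 / 2 ^ n\<close>
  times a constant.\<close>

lemma tail_bound:
  fixes d w :: "'b \<Rightarrow> nat" and Q :: "'b \<Rightarrow> real"
  assumes fin: "finite \<Phi>" and Q: "\<And>f. f \<in> \<Phi> \<Longrightarrow> 1 < Q f"
  shows "\<exists>K. \<forall>n. (\<Sum>g\<in>PiE \<Phi> (\<lambda>_. {..n}). \<bar>\<Prod>f\<in>\<Phi>. euler_coeff (Q f) (g f)\<bar> * 2 ^ (\<Sum>f\<in>\<Phi>. g f * d f)) \<le> K"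
proof (intro exI allI)
  fix n :: nat
  have "(\<Sum>g\<in>PiE \<Phi> (\<lambda>_. {..n}). \<bar>\<Prod>f\<in>\<Phi>. euler_coeff (Q f) (g f)\<bar> * 2 ^ (\<Sum>f\<in>\<Phi>. g f * d f))
      = (\<Sum>g\<in>PiE \<Phi> (\<lambda>_. {..n}). \<Prod>f\<in>\<Phi>. \<bar>euler_coeff (Q f) (g f)\<bar> * \<bar>2 ^ d f\<bar> ^ g f)"
    by (simp add: abs_prod prod.distrib power_sum power_mult[symmetric] mult.commute)
  also have "\<dots> = (\<Prod>f\<in>\<Phi>. \<Sum>r\<in>{..n}. \<bar>euler_coeff (Q f) r\<bar> * \<bar>2 ^ d f\<bar> ^ r)"
    \<comment> \<open>The weight is multiplicative over \<Phi>, so the sum over multiplicity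
      functions splits into partial sums, each bounded by a full series that does not depend on
      n.\<close>
    by (rule prod_sum_PiE[symmetric]) (use fin in auto)
  also have "\<dots> \<le> (\<Prod>f\<in>\<Phi>. \<Sum>r. \<bar>euler_coeff (Q f) r\<bar> * \<bar>2 ^ d f\<bar> ^ r)"
    by (intro prod_mono conjI sum_nonneg sum_le_suminf summable_abs_euler_coeff Q) auto
  finally show "(\<Sum>g\<in>PiE \<Phi> (\<lambda>_. {..n}). \<bar>\<Prod>f\<in>\<Phi>. euler_coeff (Q f) (g f)\<bar> * 2 ^ (\<Sum>f\<in>\<Phi>. g f * d f))
      \<le> (\<Prod>f\<in>\<Phi>. \<Sum>r. \<bar>euler_coeff (Q f) r\<bar> * \<bar>2 ^ d f\<bar> ^ r)" .
qed

text \<open>Averaging the expanded indicator over the coset turns each term g into its coefficient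
  times a mean number of embeddings, while the product of truncated sums is the same expression with
  all means replaced by 1. Only terms of dimension at least n can differ.\<close>

lemma proportion_bound:
  fixes d :: "'a::{field,finite}" and t n :: nat
  defines "\<Phi> \<equiv> small_irreducibles t :: 'a poly set" and "Q \<equiv> \<lambda>f :: 'a poly. real CARD('a) ^ degree f"
  assumes n: "0 < n" and d: "d \<noteq> 0"
  shows "\<bar>real (card {A \<in> det_set n d. no_irred_factor_upto t (char_poly A)}) / real (card (det_set n d))
      - (\<Prod>f\<in>\<Phi>. \<Sum>r\<le>n. euler_coeff (Q f) r)\<bar>
    \<le> (\<Sum>g\<in>PiE \<Phi> (\<lambda>_. {..n}). \<bar>\<Prod>f\<in>\<Phi>. euler_coeff (Q f) (g f)\<bar> * 2 ^ (\<Sum>f\<in>\<Phi>. g f * degree f))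
      * (real (CARD('a) + 1) / 2 ^ n)"
proof -
  let ?D = "det_set n d" let ?G = "PiE \<Phi> (\<lambda>_. {..n})"
  let ?c = "\<lambda>g. \<Prod>f\<in>\<Phi>. euler_coeff (Q f) (g f)"
  let ?w = "\<lambda>g. \<Sum>f\<in>\<Phi>. g f * degree f"
  have fin: "finite \<Phi>" by (simp add: \<Phi>_def)
  have \<Phi>: "monic_irreducible f" "coeff f 0 \<noteq> 0" if "f \<in> \<Phi>" for f
    using that by (auto simp: \<Phi>_def small_irreducibles_def)
  have Dpos: "0 < real (card ?D)" using det_set_pos[OF n d] by simp
  \<comment> \<open>One list is fixed for each multiplicity function, independently of A, so that
    the sums over A and g can be exchanged.\<close>
  obtain L where L: "\<And>g. set (L g) \<subseteq> \<Phi>" "\<And>g f. f \<in> \<Phi> \<Longrightarrow> count_list (L g) f = g f"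
    "\<And>g. sum_list (map degree (L g)) = ?w g"
    using exists_list_with_counts[OF fin, where h = degree] by metis
  define E where "E g = (\<Sum>A\<in>?D. card (embeddings A (companion_sum (L g))))" for g
  have ind: "of_bool (no_irred_factor_upto t (char_poly A))
      = (\<Sum>g\<in>?G. ?c g * real (card (embeddings A (companion_sum (L g)))))"
    if "A \<in> ?D" for A
  proof -
    have A: "A \<in> carrier_mat n n" "det A \<noteq> 0" using that d by (auto simp: det_set_def)
    have emb: "real (card (embeddings A (companion_sum (L g))))
        = (\<Prod>f\<in>\<Phi>. \<Prod>i<g f. real (card (poly_kernel f A)) - Q f ^ i)" for g
      using arg_cong[OF card_embeddings_companion_sum_list[OF A(1) fin \<Phi>(1) L(1)], of real_of_int g]
      by (simp add: L(2) Q_def)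
    have "of_bool (no_irred_factor_upto t (char_poly A)) = (\<Prod>f\<in>\<Phi>. of_bool (poly_kernel f A = {0\<^sub>v n}) :: real)"
      unfolding no_irred_factor_upto_iff[OF A] \<Phi>_def[symmetric] using fin by auto
    also have "\<dots> = (\<Prod>f\<in>\<Phi>. \<Sum>r\<le>n. euler_coeff (Q f) r * (\<Prod>i<r. real (card (poly_kernel f A)) - Q f ^ i))"
      unfolding Q_def by (rule prod.cong[OF refl]) (simp only: indicator_expansion[OF A(1) \<Phi>(1)])
    also have "\<dots> = (\<Sum>g\<in>?G. \<Prod>f\<in>\<Phi>. euler_coeff (Q f) (g f) * (\<Prod>i<g f. real (card (poly_kernel f A)) - Q f ^ i))"
      by (rule prod_sum_PiE) (use fin in auto)
    also have "\<dots> = (\<Sum>g\<in>?G. ?c g * real (card (embeddings A (companion_sum (L g)))))"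
      by (simp only: prod.distrib emb)
    finally show ?thesis .
  qed
  have "real (card {A \<in> ?D. no_irred_factor_upto t (char_poly A)})
      = (\<Sum>A\<in>?D. of_bool (no_irred_factor_upto t (char_poly A)))"
    by (simp add: of_bool_def sum.If_cases Int_def)
  also have "\<dots> = (\<Sum>A\<in>?D. \<Sum>g\<in>?G. ?c g * real (card (embeddings A (companion_sum (L g)))))"
    by (rule sum.cong[OF refl ind])
  also have "\<dots> = (\<Sum>g\<in>?G. ?c g * real (E g))"
    unfolding E_def of_nat_sum sum_distrib_left by (rule sum.swap)
  finally have "real (card {A \<in> ?D. no_irred_factor_upto t (char_poly A)}) / real (card ?D)
      = (\<Sum>g\<in>?G. ?c g * (real (E g) / real (card ?D)))"
    by (simp add: sum_divide_distrib)
  moreover have "(\<Prod>f\<in>\<Phi>. \<Sum>r\<le>n. euler_coeff (Q f) r) = (\<Sum>g\<in>?G. ?c g)"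
    by (rule prod_sum_PiE) (use fin in auto)
  ultimately have "real (card {A \<in> ?D. no_irred_factor_upto t (char_poly A)}) / real (card ?D)
      - (\<Prod>f\<in>\<Phi>. \<Sum>r\<le>n. euler_coeff (Q f) r) = (\<Sum>g\<in>?G. ?c g * (real (E g) / real (card ?D) - 1))"
    by (simp add: sum_subtractf[symmetric] algebra_simps)
  then have "\<bar>real (card {A \<in> ?D. no_irred_factor_upto t (char_poly A)}) / real (card ?D)
      - (\<Prod>f\<in>\<Phi>. \<Sum>r\<le>n. euler_coeff (Q f) r)\<bar> \<le> (\<Sum>g\<in>?G. \<bar>?c g * (real (E g) / real (card ?D) - 1)\<bar>)"
    by (simp only: sum_abs)
  also have "\<dots> \<le> (\<Sum>g\<in>?G. \<bar>?c g\<bar> * 2 ^ ?w g * (real (CARD('a) + 1) / 2 ^ n))"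
  proof (rule sum_mono)
    fix g assume "g \<in> ?G"
    have M: "companion_sum (L g) \<in> carrier_mat (?w g) (?w g)"
      using companion_sum_carrier[of "L g"] unfolding L(3) .
    have det: "det (companion_sum (L g)) \<noteq> 0"
      by (rule det_companion_sum_nonzero) (use L(1) \<Phi> in blast)
    have "\<bar>real (E g) / real (card ?D) - 1\<bar> \<le> 2 ^ ?w g * (real (CARD('a) + 1) / 2 ^ n)"
    proof (cases "?w g < n")
      case True
      then have "E g = card ?D" unfolding E_def by (rule mean_card_embeddings[OF M det _ d])
      then have "real (E g) / real (card ?D) - 1 = 0" using Dpos by (auto simp: card_gt_0_iff)
      then show ?thesis by (simp only: abs_zero) simp
    next
      case False
      \<comment> \<open>The mean lies between 0 and q, so its distance from 1 is at most q + 1, and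
        in this case the factor \<open>2 ^ ?w g / 2 ^ n\<close> is at least 1.\<close>
      have "E g \<le> CARD('a) * card ?D" unfolding E_def by (rule mean_card_embeddings_le[OF M det n d])
      then have "real (E g) \<le> real (CARD('a)) * real (card ?D)" by (metis of_nat_mono of_nat_mult)
      then have le: "real (E g) / real (card ?D) \<le> real (CARD('a))" using Dpos by (simp add: field_simps)
      have ge: "0 \<le> real (E g) / real (card ?D)" by simp
      have "\<bar>real (E g) / real (card ?D) - 1\<bar> \<le> 1 * real (CARD('a) + 1)"
        unfolding mult_1_left of_nat_add of_nat_1 using le ge by linarith
      also have "\<dots> \<le> (2 ^ ?w g / 2 ^ n) * real (CARD('a) + 1)"
        using False by (intro mult_right_mono) (auto simp: divide_simps intro!: power_increasing)
      finally show ?thesis by (simp add: mult.commute)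
    qed
    then have "\<bar>?c g\<bar> * \<bar>real (E g) / real (card ?D) - 1\<bar> \<le> \<bar>?c g\<bar> * (2 ^ ?w g * (real (CARD('a) + 1) / 2 ^ n))"
      by (rule mult_left_mono) simp
    then show "\<bar>?c g * (real (E g) / real (card ?D) - 1)\<bar> \<le> \<bar>?c g\<bar> * 2 ^ ?w g * (real (CARD('a) + 1) / 2 ^ n)"
      by (simp only: abs_mult mult.assoc)
  qed
  finally show ?thesis by (simp only: sum_distrib_right)
qed

theorem theorem2p4:
  fixes q t :: nat
    and C :: "nat \<Rightarrow> 'a::{field,finite} mat set"
  assumes "q = CARD('a)"
    and "t \<ge> 1"
    and "\<And>n. C n \<in> rcosets\<^bsub>GL n\<^esub> SL n"
  shows "(\<lambda>n. real (card {A \<in> C n. no_irred_factor_upto t (char_poly A)}) / real (card (C n)))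
           \<longlonglongrightarrow> (\<Prod>j=1..t. \<Prod>i. (1 - 1 / real q ^ (Suc i * j)) ^ num_irred TYPE('a) j)"
proof -
  let ?\<Phi> = "small_irreducibles t :: 'a poly set" and ?Q = "\<lambda>f :: 'a poly. real CARD('a) ^ degree f"
  let ?p = "\<lambda>n. real (card {A \<in> C n. no_irred_factor_upto t (char_poly A)}) / real (card (C n))"
  let ?a = "\<lambda>n. \<Prod>f\<in>?\<Phi>. \<Sum>r\<le>n. euler_coeff (?Q f) r"
  have q: "1 < CARD('a)" using card_mono[of "UNIV :: 'a set" "{0,1}"] by simp
  have Q: "1 < ?Q f" if "f \<in> ?\<Phi>" for f
    using that q irreducible_poly_degree_pos[of f]
    by (intro one_less_power) (auto simp: small_irreducibles_def monic_irreducible_def)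
  have "?a \<longlonglongrightarrow> (\<Prod>f\<in>?\<Phi>. \<Prod>i. 1 - 1 / ?Q f ^ Suc i)"
    by (intro tendsto_prod euler_product Q)
  then have lim: "?a \<longlonglongrightarrow> (\<Prod>j=1..t. \<Prod>i. (1 - 1 / real q ^ (Suc i * j)) ^ num_irred TYPE('a) j)"
    unfolding assms(1) prodinf_by_degree[OF q, where 'a = 'a] .
  obtain K where K: "\<And>n. (\<Sum>g\<in>PiE ?\<Phi> (\<lambda>_. {..n}). \<bar>\<Prod>f\<in>?\<Phi>. euler_coeff (?Q f) (g f)\<bar>
      * 2 ^ (\<Sum>f\<in>?\<Phi>. g f * degree f)) \<le> K"
    using tail_bound[of ?\<Phi> ?Q degree] Q by auto
  \<comment> \<open>Positive n is required to identify \<open>C n\<close> with a determinant class.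
    The determinant may vary with n, but the bound is uniform in it.\<close>
  have bound: "norm (?p n - ?a n) \<le> K * real (CARD('a) + 1) * (1 / 2) ^ n" if "0 < n" for n
  proof -
    have "\<exists>d. d \<noteq> 0 \<and> C n = det_set n d"
      using assms(3)[of n] unfolding rcosets_SL[OF that] det_set_def by blast
    then obtain d where d: "d \<noteq> 0" "C n = det_set n d" by blast
    have "norm (?p n - ?a n) \<le> K * (real (CARD('a) + 1) / 2 ^ n)"
      unfolding d(2) real_norm_def
      by (rule order_trans[OF proportion_bound[OF that d(1)] mult_right_mono[OF K]]) simp
    then show ?thesis by (simp add: power_one_over)
  qed
  have "(\<lambda>n. K * real (CARD('a) + 1) * (1 / 2) ^ n) \<longlonglongrightarrow> 0"
    by (intro tendsto_mult_right_zero LIMSEQ_realpow_zero) auto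
  then have "(\<lambda>n. ?p n - ?a n) \<longlonglongrightarrow> 0"
    by (rule Lim_null_comparison[rotated]) (use bound in \<open>auto intro: eventually_sequentiallyI[of 1]\<close>)
  from tendsto_add[OF this lim] show ?thesis by simp
qed

end
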